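(* Let $d\in\mathbb{N}_{\geq 2}$ and $\mathscr{C}\subset C([0,1]^{d-1},[0,1])$. Assume that there are $\alpha\geq\beta>0$ and $a,b\geq 0$ such that, for all $0<\varepsilon<1$, $$\varepsilon^{-1/\beta}\,\ln^b(2+\varepsilon^{-1})\;\gtrsim\; M_{\mathscr{C},L^1}(\varepsilon)\;\gtrsim\;\varepsilon^{-1/\alpha}\big/\ln^a(2+\varepsilon^{-1}),$$ with implied constants independent of $\varepsilon$. Then there exist constants $C_1,C_2>0$ such that for all $m\in\mathbb{N}$ $$\kappa_1(m)\;\leq\;\inf_{A\in\mathcal{A}_m(\Lambda,L^2)}\;\sup_{h\in H_{\mathscr{C}}}\;\mathbb{E}_{(X_i)_{i=1}^m\overset{iid}{\sim}\boldsymbol{\lambda}}\Big\|A\bigl((X_i,h(X_i))_{i=1}^m\bigr)-h\Big\|_{L^2(\boldsymbol{\lambda})}^2\;\leq\;\kappa_2(m),$$ where $$\kappa_1(m)=C_1\, m^{-\alpha/(\beta+1)}\,[\ln(2m)]^{-\alpha(2+\beta b)/(\beta+1)-\alpha a},\qquad \kappa_2(m)=C_2\, m^{-\beta/(\beta+1)}\,[\ln(2m)]^{(2+\beta b)/(\beta+1)} .$$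
   Context: $\boldsymbol{\lambda}$ is the uniform (Lebesgue) probability measure on $[0,1]^d$. $\Lambda:=[0,1]^d\times\{0,1\}$, and $\mathcal{A}_m(\Lambda,L^2)$ is the set of all measurable maps $\Lambda^m\to L^2([0,1]^d)$ (estimators). For $b:[0,1]^{d-1}\to[0,1]$, the horizon function $h_b:[0,1]^d\to\{0,1\}$ is $h_b(x)=1$ if $b(x_1,\dots,x_{d-1})\leq x_d$ and $h_b(x)=0$ otherwise; $H_{\mathscr{C}}:=\{h_b:b\in\mathscr{C}\}$. Packing entropy: for a nonempty subset $K$ of a set with distance function $\mathrm{dist}$ and $\varepsilon>0$, an $\varepsilon$-packing set in $K$ is a set $N\subset K$ with $\mathrm{dist}(x_1,x_2)>\varepsilon$ for all distinct $x_1,x_2\in N$. $M_{K,\mathrm{dist}}(\varepsilon)$ is the natural logarithm of the maximal cardinality of an $\varepsilon$-packing set in $K$. $M_{\mathscr{C},L^1}$ denotes the packing entropy of $\mathscr{C}$ with respect to the $L^1$ distance (Lebesgue measure on $[0,1]^{d-1}$). *)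

theory Defs
  imports "HOL-Probability.Probability"
begin

text \<open>
  Points of \<open>[0,1]^k\<close> are extensional functions on the index set \<open>{..<k}\<close>, so the coordinates
  \<open>x_1, \<dots>, x_k\<close> of the mathematical text are \<open>x 0, \<dots>, x (k - 1)\<close>.
\<close>

definition cube :: "nat \<Rightarrow> (nat \<Rightarrow> real) set" where
  "cube k = ({..<k} \<rightarrow>\<^sub>E {0..1})"

definition cube_measure :: "nat \<Rightarrow> (nat \<Rightarrow> real) measure" where
  "cube_measure k = (\<Pi>\<^sub>M i\<in>{..<k}. restrict_space lborel {0..1})"

text \<open>
  The topology on \<open>nat \<Rightarrow> real\<close> is the product topology; on \<open>cube k\<close> it induces the Euclidean
  topology, since the coordinates outside \<open>{..<k}\<close> are constant there. The values of a function
  outside \<open>cube k\<close> are irrelevant everywhere below.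
\<close>

definition cont_cube_unit :: "nat \<Rightarrow> ((nat \<Rightarrow> real) \<Rightarrow> real) set" where
  "cont_cube_unit k = {b. continuous_on (cube k) b \<and> b ` cube k \<subseteq> {0..1}}"

definition horizon :: "nat \<Rightarrow> ((nat \<Rightarrow> real) \<Rightarrow> real) \<Rightarrow> (nat \<Rightarrow> real) \<Rightarrow> real" where
  "horizon d b x = (if b (restrict x {..<d - 1}) \<le> x (d - 1) then 1 else 0)"

definition horizons :: "nat \<Rightarrow> ((nat \<Rightarrow> real) \<Rightarrow> real) set \<Rightarrow> ((nat \<Rightarrow> real) \<Rightarrow> real) set" where
  "horizons d \<C> = horizon d ` \<C>"


definition packing_set :: "('a \<Rightarrow> 'a \<Rightarrow> real) \<Rightarrow> 'a set \<Rightarrow> real \<Rightarrow> 'a set \<Rightarrow> bool" where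
  "packing_set \<delta> K \<epsilon> N \<longleftrightarrow> N \<subseteq> K \<and> (\<forall>x\<in>N. \<forall>y\<in>N. x \<noteq> y \<longrightarrow> \<epsilon> < \<delta> x y)"

text \<open>
  Subsets of packing sets are packing sets, so the supremum over finite packing sets is \<open>\<infinity>\<close> as
  soon as there is an infinite packing set, and it is the maximal cardinality if it is finite.
\<close>

definition packing_number :: "('a \<Rightarrow> 'a \<Rightarrow> real) \<Rightarrow> 'a set \<Rightarrow> real \<Rightarrow> enat" where
  "packing_number \<delta> K \<epsilon> = (SUP N\<in>{N. finite N \<and> packing_set \<delta> K \<epsilon> N}. enat (card N))"

definition packing_entropy :: "('a \<Rightarrow> 'a \<Rightarrow> real) \<Rightarrow> 'a set \<Rightarrow> real \<Rightarrow> ereal" where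
  "packing_entropy \<delta> K \<epsilon> =
     (case packing_number \<delta> K \<epsilon> of enat n \<Rightarrow> ereal (ln (real n)) | \<infinity> \<Rightarrow> \<infinity>)"

definition L1_dist :: "'a measure \<Rightarrow> ('a \<Rightarrow> real) \<Rightarrow> ('a \<Rightarrow> real) \<Rightarrow> real" where
  "L1_dist M f g = (\<integral>x. \<bar>f x - g x\<bar> \<partial>M)"


text \<open>
  \<open>L\<^sup>2(M)\<close> is represented by square integrable functions, not by their classes modulo equality
  almost everywhere. Its Borel \<open>\<sigma>\<close>-algebra is generated by the open sets of the \<open>L\<^sup>2\<close> pseudometric,
  all of which are unions of such classes; hence it is the pullback of the Borel \<open>\<sigma>\<close>-algebra of
  the quotient, and measurable maps into the quotient are exactly the classes of measurable maps
  into \<open>L2_space M\<close>.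
\<close>

definition L2_functions :: "'a measure \<Rightarrow> ('a \<Rightarrow> real) set" where
  "L2_functions M = {f \<in> borel_measurable M. integrable M (\<lambda>x. (f x)\<^sup>2)}"

definition L2_nrm :: "'a measure \<Rightarrow> ('a \<Rightarrow> real) \<Rightarrow> real" where
  "L2_nrm M f = sqrt (\<integral>x. (f x)\<^sup>2 \<partial>M)"

definition L2_open :: "'a measure \<Rightarrow> ('a \<Rightarrow> real) set \<Rightarrow> bool" where
  "L2_open M U \<longleftrightarrow> U \<subseteq> L2_functions M \<and>
     (\<forall>f\<in>U. \<exists>r>0. \<forall>g\<in>L2_functions M. L2_nrm M (\<lambda>x. g x - f x) < r \<longrightarrow> g \<in> U)"

definition L2_space :: "'a measure \<Rightarrow> ('a \<Rightarrow> real) measure" where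
  "L2_space M = sigma (L2_functions M) {U. L2_open M U}"


definition labelled_space :: "nat \<Rightarrow> ((nat \<Rightarrow> real) \<times> real) measure" where
  "labelled_space d = restrict_space borel (cube d) \<Otimes>\<^sub>M count_space {0, 1}"

definition estimators ::
    "nat \<Rightarrow> nat \<Rightarrow> ((nat \<Rightarrow> (nat \<Rightarrow> real) \<times> real) \<Rightarrow> (nat \<Rightarrow> real) \<Rightarrow> real) set" where
  "estimators d m =
     (\<Pi>\<^sub>M i\<in>{..<m}. labelled_space d) \<rightarrow>\<^sub>M L2_space (cube_measure d)"

definition sample ::
    "nat \<Rightarrow> ('a \<Rightarrow> real) \<Rightarrow> (nat \<Rightarrow> 'a) \<Rightarrow> nat \<Rightarrow> 'a \<times> real" where
  "sample m h X = (\<lambda>i\<in>{..<m}. (X i, h (X i)))"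

definition risk ::
    "nat \<Rightarrow> nat \<Rightarrow> ((nat \<Rightarrow> (nat \<Rightarrow> real) \<times> real) \<Rightarrow> (nat \<Rightarrow> real) \<Rightarrow> real) \<Rightarrow>
     ((nat \<Rightarrow> real) \<Rightarrow> real) \<Rightarrow> ennreal" where
  "risk d m A h =
     (\<integral>\<^sup>+ X. ennreal ((L2_nrm (cube_measure d) (\<lambda>x. A (sample m h X) x - h x))\<^sup>2)
        \<partial>(\<Pi>\<^sub>M i\<in>{..<m}. cube_measure d))"

definition minimax_risk :: "nat \<Rightarrow> nat \<Rightarrow> ((nat \<Rightarrow> real) \<Rightarrow> real) set \<Rightarrow> ennreal" where
  "minimax_risk d m H = (INF A\<in>estimators d m. SUP h\<in>H. risk d m A h)"

end

theory Submission
  imports Defs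
begin

text \<open>
  Since the squared \<open>L\<^sup>2\<close> distance of two horizon functions is the \<open>L\<^sup>1\<close> distance of their boundaries,
  both bounds are metric entropy arguments in \<open>\<C>\<close>.

  Upper bound: minimise the number of errors on the sample over an \<open>\<epsilon>\<close>-net. A function of the net
  at squared distance more than \<open>4\<epsilon>\<close> from the truth beats the best one with probability at most
  \<open>exp (- m \<epsilon>)\<close>, so a union bound gives risk of order \<open>\<epsilon>\<close> as soon as \<open>m \<epsilon>\<close> dominates the
  entropy at scale \<open>\<epsilon>\<close>.

  Lower bound: the \<open>m\<close> labels carry far fewer than \<open>m\<close> bits. They agree with the labels of an element
  of a \<open>\<delta>\<close>-net up to at most \<open>2 m \<delta>\<close> errors, with probability at least \<open>1/2\<close>. Hence for fixed sample
  points the typical labels take at most \<open>exp (M(\<delta>)) (m + 1)\<^bsup>2 m \<delta>\<^esup>\<close> values, and an estimator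
  can approximate at most that many elements of an \<open>\<epsilon>\<close>-packing. The choice of \<open>\<delta>\<close> balances \<open>M(\<delta>)\<close>
  against \<open>m \<delta> ln m\<close>, and then \<open>\<epsilon>\<close> is chosen such that the \<open>\<epsilon>\<close>-packing is larger.
\<close>

section \<open>Packings and nets\<close>

text \<open>A finite supremum of a nonempty set of extended naturals is attained, because such a set
  is finite. So a real bound on the entropy yields a packing set of maximal cardinality.\<close>

lemma packing_entropy_attained:
  assumes "packing_entropy \<delta> K \<epsilon> \<le> ereal v"
  obtains N where "finite N" "packing_set \<delta> K \<epsilon> N"
    "packing_entropy \<delta> K \<epsilon> = ereal (ln (real (card N)))"
    "\<And>N'. finite N' \<Longrightarrow> packing_set \<delta> K \<epsilon> N' \<Longrightarrow> card N' \<le> card N"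
proof -
  define S where "S = (\<lambda>N. enat (card N)) ` {N. finite N \<and> packing_set \<delta> K \<epsilon> N}"
  have num: "packing_number \<delta> K \<epsilon> = Sup S"
    by (simp add: packing_number_def S_def)
  have "{} \<in> {N. finite N \<and> packing_set \<delta> K \<epsilon> N}"
    by (auto simp: packing_set_def)
  then have "S \<noteq> {}"
    unfolding S_def by blast
  have ne: "Sup S \<noteq> \<infinity>"
  proof
    assume "Sup S = \<infinity>"
    then have "packing_entropy \<delta> K \<epsilon> = \<infinity>"
      by (simp only: packing_entropy_def num enat.case)
    with assms show False by simp
  qed
  have "finite S"
    using ne \<open>S \<noteq> {}\<close> unfolding Sup_enat_def by (simp split: if_split_asm)
  then have "Sup S \<in> S"
    using \<open>S \<noteq> {}\<close> unfolding Sup_enat_def by simp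
  then obtain N where N: "finite N" "packing_set \<delta> K \<epsilon> N" "Sup S = enat (card N)"
    by (auto simp: S_def)
  show ?thesis
  proof
    show "packing_entropy \<delta> K \<epsilon> = ereal (ln (real (card N)))"
      by (simp add: packing_entropy_def num N)
    show "card N' \<le> card N" if "finite N'" "packing_set \<delta> K \<epsilon> N'" for N'
    proof -
      have "enat (card N') \<le> Sup S"
        using that by (intro Sup_upper) (auto simp: S_def)
      then show ?thesis by (simp add: N)
    qed
  qed (use N in auto)
qed

lemma packing_set_subset: "packing_set \<delta> K \<epsilon> N \<Longrightarrow> N \<subseteq> K"
  by (simp add: packing_set_def)

text \<open>A point at distance more than \<epsilon> from all of \<open>N\<close> could be added to
  \<open>N\<close>, against maximality. This turns packing sets into nets.\<close>

lemma maximal_packing_set_covers: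
  assumes "finite N" "packing_set \<delta> K \<epsilon> N"
    and max: "\<And>N'. finite N' \<Longrightarrow> packing_set \<delta> K \<epsilon> N' \<Longrightarrow> card N' \<le> card N"
    and sym: "\<And>x y. \<delta> x y = \<delta> y x" and refl: "\<And>x. \<delta> x x \<le> \<epsilon>"
    and "x \<in> K"
  shows "\<exists>y\<in>N. \<delta> x y \<le> \<epsilon>"
proof (rule ccontr)
  assume *: "\<not> (\<exists>y\<in>N. \<delta> x y \<le> \<epsilon>)"
  then have "x \<notin> N" using refl by auto
  have "packing_set \<delta> K \<epsilon> (insert x N)"
    unfolding packing_set_def
  proof (intro conjI ballI impI)
    show "insert x N \<subseteq> K"
      using \<open>x \<in> K\<close> packing_set_subset[OF assms(2)] by simp
    have far: "\<epsilon> < \<delta> x y" "\<epsilon> < \<delta> y x" if "y \<in> N" for y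
      using * that sym[of y x] by force+
    have sep: "\<epsilon> < \<delta> y z" if "y \<in> N" "z \<in> N" "y \<noteq> z" for y z
      using assms(2) that unfolding packing_set_def by blast
    show "\<epsilon> < \<delta> y z" if "y \<in> insert x N" "z \<in> insert x N" "y \<noteq> z" for y z
      using that far sep by auto
  qed
  then have "card (insert x N) \<le> card N"
    using \<open>finite N\<close> by (intro max) auto
  then show False
    using \<open>finite N\<close> \<open>x \<notin> N\<close> by simp
qed

lemma L1_dist_commute: "L1_dist M f g = L1_dist M g f"
  by (simp add: L1_dist_def abs_minus_commute)

lemma L1_dist_self: "L1_dist M f f = 0"
  by (simp add: L1_dist_def)

section \<open>Horizon functions on the cube\<close>

lemma prob_space_unit_interval: "prob_space (restrict_space lborel {0..1::real})"
  by (intro prob_spaceI) (simp add: space_restrict_space emeasure_restrict_space)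

lemma product_sigma_finite_unit_interval:
  "product_sigma_finite (\<lambda>i::nat. restrict_space lborel {0..1::real})"
  by (intro product_sigma_finite.intro prob_space_imp_sigma_finite prob_space_unit_interval)

lemma prob_space_cube_measure: "prob_space (cube_measure k)"
  unfolding cube_measure_def by (intro prob_space_PiM prob_space_unit_interval)

lemma space_cube_measure: "space (cube_measure k) = cube k"
  by (simp add: cube_measure_def cube_def space_PiM space_restrict_space)

lemma component_measurable_cube_measure:
  assumes "i < k"
  shows "(\<lambda>x. x i) \<in> borel_measurable (cube_measure k)"
proof -
  have "(\<lambda>x. x i) \<in> cube_measure k \<rightarrow>\<^sub>M restrict_space lborel {0..1}"
    unfolding cube_measure_def using assms by (intro measurable_component_singleton) auto
  then show ?thesis
    by (auto simp: measurable_restrict_space2_iff)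
qed

text \<open>Links the product \<sigma>-algebra of \<open>cube_measure\<close> to the Borel
  \<sigma>-algebra of the cube, which \<open>labelled_space\<close> uses. The Borel \<sigma>-algebra
  of \<open>nat \<Rightarrow> real\<close> is the product one, so every coordinate is checked
  separately.\<close>

lemma ident_measurable_cube_measure:
  "(\<lambda>x. x) \<in> cube_measure k \<rightarrow>\<^sub>M restrict_space borel (cube k)"
proof (rule measurable_restrict_space2)
  show "(\<lambda>x. x) \<in> space (cube_measure k) \<rightarrow> cube k"
    by (simp add: space_cube_measure)
  have "(\<lambda>x. x i) \<in> borel_measurable (cube_measure k)" for i
  proof (cases "i < k")
    case False
    \<comment> \<open>Points of the cube are extensional, so the coordinates outside the index set
      are constant.\<close>
    have "x i = undefined" if "x \<in> space (cube_measure k)" for x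
      using that False by (auto simp: space_cube_measure cube_def PiE_def extensional_def)
    then show ?thesis
      by (subst measurable_cong[of _ _ "\<lambda>_. undefined"]) auto
  qed (rule component_measurable_cube_measure)
  then have "(\<lambda>x. x) \<in> cube_measure k \<rightarrow>\<^sub>M Pi\<^sub>M UNIV (\<lambda>_. borel)"
    by (intro measurable_PiM_single') auto
  then show "(\<lambda>x. x) \<in> cube_measure k \<rightarrow>\<^sub>M borel"
    by (simp add: measurable_cong_sets[OF refl sets_PiM_equal_borel])
qed

lemma borel_measurable_cube_measureI:
  assumes "f \<in> borel_measurable (restrict_space borel (cube k))"
  shows "f \<in> borel_measurable (cube_measure k)"
  using measurable_comp[OF ident_measurable_cube_measure assms] by (simp add: comp_def)

lemma restrict_mem_cube: "x \<in> cube d \<Longrightarrow> k \<le> d \<Longrightarrow> restrict x {..<k} \<in> cube k"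
  by (auto simp: cube_def PiE_def Pi_def)

text \<open>Both sides of the comparison in \<open>horizon\<close> are continuous on the cube. The
  Borel \<sigma>-algebra of the cube is the one that the sample points carry in
  \<open>labelled_space\<close>.\<close>

lemma horizon_measurable:
  assumes "b \<in> cont_cube_unit (d - 1)"
  shows "horizon d b \<in> borel_measurable (restrict_space borel (cube d))"
proof -
  have restr: "continuous_on (cube d) (\<lambda>x. restrict x {..<d - 1})"
  proof (rule continuous_on_coordinatewise_then_product)
    show "continuous_on (cube d) (\<lambda>x. restrict x {..<d - 1} i)" for i
      by (cases "i < d - 1")
        (auto intro: continuous_on_subset[OF continuous_on_product_coordinates])
  qed
  have "continuous_on (cube d) (\<lambda>x. b (restrict x {..<d - 1}))"
    using assms restrict_mem_cube[of _ d "d - 1"]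
    by (intro continuous_on_compose2[OF _ restr]) (auto simp: cont_cube_unit_def)
  moreover have "continuous_on (cube d) (\<lambda>x. x (d - 1))"
    by (rule continuous_on_subset[OF continuous_on_product_coordinates]) simp
  ultimately have [measurable]:
    "(\<lambda>x. b (restrict x {..<d - 1})) \<in> borel_measurable (restrict_space borel (cube d))"
    "(\<lambda>x. x (d - 1)) \<in> borel_measurable (restrict_space borel (cube d))"
    by (simp_all add: borel_measurable_continuous_on_restrict)
  show ?thesis
    unfolding horizon_def by measurable
qed

lemma horizon_range: "horizon d b x \<in> {0, 1}"
  by (simp add: horizon_def)

text \<open>The integrand is the indicator of the half-open interval between the two thresholds,
  which lies in the unit interval.\<close>

lemma nn_integral_unit_interval_thresholds:
  fixes s t :: real
  assumes "s \<in> {0..1}" "t \<in> {0..1}"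
  shows "(\<integral>\<^sup>+u. ennreal (((if s \<le> u then 1 else 0) - (if t \<le> u then 1 else 0))\<^sup>2)
           \<partial>restrict_space lborel {0..1}) = ennreal \<bar>s - t\<bar>"
proof -
  have "(\<integral>\<^sup>+u. ennreal (((if s \<le> u then 1 else 0) - (if t \<le> u then 1 else 0))\<^sup>2)
           \<partial>restrict_space lborel {0..1})
      = (\<integral>\<^sup>+u. ennreal (((if s \<le> u then 1 else 0) - (if t \<le> u then 1 else 0))\<^sup>2)
           * indicator {0..1} u \<partial>lborel)"
    by (simp add: nn_integral_restrict_space)
  also have "\<dots> = (\<integral>\<^sup>+u. indicator {min s t..<max s t} u \<partial>lborel)"
    using assms by (intro nn_integral_cong) (auto simp: indicator_def)
  also have "\<dots> = ennreal \<bar>s - t\<bar>"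
    by (simp add: min_def max_def)
  finally show ?thesis .
qed

text \<open>Integrate over the last coordinate first: above a point \<open>x\<close> the two horizon
  functions differ exactly between \<open>b x\<close> and \<open>b' x\<close>, which contributes
  \<open>\<bar>b x - b' x\<bar>\<close>. Packing sets and nets of boundaries thus become packing
  sets and nets of horizon functions for the squared distance.\<close>

lemma horizon_sq_dist:
  assumes "d \<ge> 1" "b \<in> cont_cube_unit (d - 1)" "b' \<in> cont_cube_unit (d - 1)"
  shows "(\<integral>x. (horizon d b x - horizon d b' x)\<^sup>2 \<partial>cube_measure d)
    = L1_dist (cube_measure (d - 1)) b b'"
proof -
  interpret product_sigma_finite "\<lambda>i::nat. restrict_space lborel {0..1::real}"
    by (rule product_sigma_finite_unit_interval)
  define k where "k = d - 1"
  have d: "d = Suc k" using \<open>d \<ge> 1\<close> by (simp add: k_def)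
  have bm: "g \<in> borel_measurable (cube_measure k)" if "g \<in> cont_cube_unit (d - 1)" for g
    using that by (intro borel_measurable_cube_measureI borel_measurable_continuous_on_restrict)
      (auto simp: cont_cube_unit_def k_def)
  have range: "g x \<in> {0..1}" if "g \<in> cont_cube_unit (d - 1)" "x \<in> cube k" for g x
    using that by (auto simp: cont_cube_unit_def k_def)
  have [measurable]: "horizon d b \<in> borel_measurable (cube_measure d)"
    "horizon d b' \<in> borel_measurable (cube_measure d)"
    by (intro borel_measurable_cube_measureI horizon_measurable assms)+
  have "(\<integral>\<^sup>+x. ennreal ((horizon d b x - horizon d b' x)\<^sup>2) \<partial>cube_measure d)
      = (\<integral>\<^sup>+x. (\<integral>\<^sup>+u. ennreal ((horizon d b (x(k := u)) - horizon d b' (x(k := u)))\<^sup>2)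
           \<partial>restrict_space lborel {0..1}) \<partial>cube_measure k)"
    unfolding cube_measure_def d lessThan_Suc
    by (subst product_nn_integral_insert)
       (auto simp flip: lessThan_Suc d cube_measure_def)
  also have "\<dots> = (\<integral>\<^sup>+x. ennreal \<bar>b x - b' x\<bar> \<partial>cube_measure k)"
  proof (rule nn_integral_cong)
    fix x assume "x \<in> space (cube_measure k)"
    then have x: "x \<in> cube k" by (simp add: space_cube_measure)
    then have "restrict (x(k := u)) {..<k} = x" for u
      by (auto simp: cube_def fun_eq_iff PiE_def extensional_def)
    then have "horizon d g (x(k := u)) = (if g x \<le> u then 1 else 0)" for u g
      by (simp add: horizon_def d)
    then show "(\<integral>\<^sup>+u. ennreal ((horizon d b (x(k := u)) - horizon d b' (x(k := u)))\<^sup>2)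
           \<partial>restrict_space lborel {0..1}) = ennreal \<bar>b x - b' x\<bar>"
      using range[OF assms(2) x] range[OF assms(3) x]
      by (simp add: nn_integral_unit_interval_thresholds)
  qed
  finally have "(\<integral>\<^sup>+x. ennreal ((horizon d b x - horizon d b' x)\<^sup>2) \<partial>cube_measure d)
      = (\<integral>\<^sup>+x. ennreal \<bar>b x - b' x\<bar> \<partial>cube_measure k)" .
  then show ?thesis
    using bm[OF assms(2)] bm[OF assms(3)]
    unfolding L1_dist_def k_def[symmetric] by (simp add: integral_eq_nn_integral)
qed

section \<open>The \<open>L\<^sup>2\<close> pseudometric\<close>

lemma space_L2_space: "space (L2_space M) = L2_functions M"
  and L2_open_in_sets: "L2_open M U \<Longrightarrow> U \<in> sets (L2_space M)"
proof -
  have "{U. L2_open M U} \<subseteq> Pow (L2_functions M)"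
    by (auto simp: L2_open_def)
  then show "space (L2_space M) = L2_functions M" "L2_open M U \<Longrightarrow> U \<in> sets (L2_space M)"
    by (auto simp: L2_space_def)
qed

lemma L2_functions_diff:
  assumes "f \<in> L2_functions M" "g \<in> L2_functions M"
  shows "(\<lambda>x. f x - g x) \<in> L2_functions M"
proof -
  have [measurable]: "f \<in> borel_measurable M" "g \<in> borel_measurable M"
    using assms by (auto simp: L2_functions_def)
  have "integrable M (\<lambda>x. 2 * (f x)\<^sup>2 + 2 * (g x)\<^sup>2)"
    using assms by (auto simp: L2_functions_def)
  then have "integrable M (\<lambda>x. (f x - g x)\<^sup>2)"
  proof (rule Bochner_Integration.integrable_bound)
    show "AE x in M. norm ((f x - g x)\<^sup>2) \<le> norm (2 * (f x)\<^sup>2 + 2 * (g x)\<^sup>2)"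
    proof (intro AE_I2)
      fix x
      have "(f x - g x)\<^sup>2 = 2 * (f x)\<^sup>2 + 2 * (g x)\<^sup>2 - (f x + g x)\<^sup>2"
        by (simp add: power2_diff power2_sum)
      also have "\<dots> \<le> 2 * (f x)\<^sup>2 + 2 * (g x)\<^sup>2"
        by simp
      finally show "norm ((f x - g x)\<^sup>2) \<le> norm (2 * (f x)\<^sup>2 + 2 * (g x)\<^sup>2)"
        by simp
    qed
  qed measurable
  then show ?thesis
    by (auto simp: L2_functions_def)
qed

lemma L2_nrm_sq: "(L2_nrm M f)\<^sup>2 = (\<integral>x. (f x)\<^sup>2 \<partial>M)"
  by (simp add: L2_nrm_def)

lemma L2_nrm_nonneg: "0 \<le> L2_nrm M f"
  by (simp add: L2_nrm_def)

text \<open>Integrates a pointwise inequality that is \<open>(t * u + v)\<^sup>2 / t \<ge> 0\<close>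
  rearranged. It takes the place of the triangle inequality: \<open>t = 1\<close> serves the
  separation argument of the lower bound, small \<open>t\<close> the openness of balls.\<close>

lemma L2_nrm_sq_add_le:
  assumes "f \<in> L2_functions M" "g \<in> L2_functions M" "t > 0"
  shows "(L2_nrm M (\<lambda>x. f x - g x))\<^sup>2 \<le> (1 + t) * (L2_nrm M f)\<^sup>2 + (1 + 1 / t) * (L2_nrm M g)\<^sup>2"
proof -
  have "(u - v)\<^sup>2 \<le> (1 + t) * u\<^sup>2 + (1 + 1 / t) * v\<^sup>2" for u v :: real
  proof -
    have "0 \<le> (t * u + v)\<^sup>2 / t" using \<open>t > 0\<close> by simp
    also have "\<dots> = (1 + t) * u\<^sup>2 + (1 + 1 / t) * v\<^sup>2 - (u - v)\<^sup>2"
      using \<open>t > 0\<close> by (simp add: field_simps power2_eq_square)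
    finally show ?thesis by simp
  qed
  then have "(\<integral>x. (f x - g x)\<^sup>2 \<partial>M) \<le> (\<integral>x. (1 + t) * (f x)\<^sup>2 + (1 + 1 / t) * (g x)\<^sup>2 \<partial>M)"
    using assms(1,2) L2_functions_diff[OF assms(1,2)] unfolding L2_functions_def
    by (intro integral_mono Bochner_Integration.integrable_add integrable_mult_right) simp_all
  also have "\<dots> = (1 + t) * (\<integral>x. (f x)\<^sup>2 \<partial>M) + (1 + 1 / t) * (\<integral>x. (g x)\<^sup>2 \<partial>M)"
    using assms(1,2) unfolding L2_functions_def
    by (subst Bochner_Integration.integral_add) simp_all
  finally show ?thesis
    by (simp add: L2_nrm_sq)
qed

text \<open>The gap \<open>r - s\<close> between the squared radius and the squared distance
  \<open>s\<close> of \<open>f\<close> from the centre is halved: \<open>t\<close> is chosen such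
  that the factor \<open>1 + t\<close> costs less than one half, and the radius
  \<open>\<rho>\<close> such that the move from \<open>f\<close> to \<open>g\<close> costs less than
  the other.\<close>

lemma L2_open_ball:
  assumes h: "h \<in> L2_functions M"
  shows "L2_open M {f \<in> L2_functions M. (L2_nrm M (\<lambda>x. f x - h x))\<^sup>2 < r}"
  unfolding L2_open_def
proof (intro conjI ballI)
  fix f assume f: "f \<in> {f \<in> L2_functions M. (L2_nrm M (\<lambda>x. f x - h x))\<^sup>2 < r}"
  define s where "s = (L2_nrm M (\<lambda>x. f x - h x))\<^sup>2"
  have "s < r" "0 \<le> s" using f by (auto simp: s_def)
  define t where "t = (r - s) / (2 * (s + 1))"
  have "t > 0" using \<open>s < r\<close> \<open>0 \<le> s\<close> by (simp add: t_def)
  have ts: "(1 + t) * s < (r + s) / 2"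
  proof -
    have "t * s < t * (s + 1)" using \<open>t > 0\<close> by simp
    also have "\<dots> = (r - s) / 2" using \<open>0 \<le> s\<close> by (simp add: t_def field_simps)
    finally show ?thesis by (simp add: algebra_simps)
  qed
  define \<rho> where "\<rho> = sqrt ((r - s) / 2 / (1 + 1 / t))"
  have "\<rho> > 0" using \<open>t > 0\<close> \<open>s < r\<close> by (simp add: \<rho>_def add_pos_pos)
  moreover have "g \<in> {f \<in> L2_functions M. (L2_nrm M (\<lambda>x. f x - h x))\<^sup>2 < r}"
    if g: "g \<in> L2_functions M" and d: "L2_nrm M (\<lambda>x. g x - f x) < \<rho>" for g
  proof -
    have "(L2_nrm M (\<lambda>x. g x - f x))\<^sup>2 < \<rho>\<^sup>2"
      using d L2_nrm_nonneg by (intro power_strict_mono) auto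
    also have "\<rho>\<^sup>2 = (r - s) / 2 / (1 + 1 / t)"
      using \<open>t > 0\<close> \<open>s < r\<close> by (simp add: \<rho>_def)
    finally have "(1 + 1 / t) * (L2_nrm M (\<lambda>x. g x - f x))\<^sup>2 < (r - s) / 2"
      using \<open>t > 0\<close> by (simp add: field_simps)
    moreover have "L2_nrm M (\<lambda>x. f x - g x) = L2_nrm M (\<lambda>x. g x - f x)"
      by (simp add: L2_nrm_def power2_commute)
    moreover have "(L2_nrm M (\<lambda>x. g x - h x))\<^sup>2
        = (L2_nrm M (\<lambda>x. (f x - h x) - (f x - g x)))\<^sup>2"
      by simp
    moreover have "\<dots> \<le> (1 + t) * s + (1 + 1 / t) * (L2_nrm M (\<lambda>x. f x - g x))\<^sup>2"
      unfolding s_def using f g h \<open>t > 0\<close> by (intro L2_nrm_sq_add_le L2_functions_diff) auto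
    ultimately have "(L2_nrm M (\<lambda>x. g x - h x))\<^sup>2 < r"
      using ts by (simp add: field_simps)
    then show ?thesis using g by simp
  qed
  ultimately show "\<exists>\<rho>>0. \<forall>g\<in>L2_functions M. L2_nrm M (\<lambda>x. g x - f x) < \<rho> \<longrightarrow>
      g \<in> {f \<in> L2_functions M. (L2_nrm M (\<lambda>x. f x - h x))\<^sup>2 < r}"
    by blast
qed auto

text \<open>The strict sublevel sets are open balls. Composed with an estimator, this makes the loss
  a measurable function of the sample points, so that the integrals in the lower bound can be
  added.\<close>

lemma L2_nrm_sq_measurable:
  assumes "h \<in> L2_functions M"
  shows "(\<lambda>f. (L2_nrm M (\<lambda>x. f x - h x))\<^sup>2) \<in> borel_measurable (L2_space M)"
proof (rule borel_measurableI_less)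
  fix r :: real
  show "{f \<in> space (L2_space M). (L2_nrm M (\<lambda>x. f x - h x))\<^sup>2 < r} \<in> sets (L2_space M)"
    using L2_open_in_sets[OF L2_open_ball[OF assms]] by (simp add: space_L2_space)
qed

lemma zero_one_valued_L2_functions:
  assumes "prob_space M" "h \<in> borel_measurable M" "\<And>x. x \<in> space M \<Longrightarrow> h x \<in> {0, 1}"
  shows "h \<in> L2_functions M"
proof -
  interpret prob_space M by fact
  have [measurable]: "h \<in> borel_measurable M" by fact
  have "integrable M (\<lambda>x. (h x)\<^sup>2)"
    using assms(3) by (intro integrable_const_bound[of _ 1] AE_I2) (auto, fastforce)
  then show ?thesis by (simp add: L2_functions_def)
qed

section \<open>Empirical risk minimisation over a finite set\<close>

text \<open>An exponential moment argument with a union bound. A function of \<open>N\<close> at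
  squared distance more than \<open>4 * \<epsilon>\<close> can be selected only if it makes at most
  as many errors as \<open>g0\<close>, and then the product of its weights \<open>w\<close> over the
  sample is at least 1, while the expectation of this product is at most
  \<open>exp (- m * \<epsilon>)\<close>. The loss is dominated pointwise by a measurable function,
  as \<open>sel\<close> is an arbitrary function.\<close>

lemma empirical_risk_minimiser_bound:
  fixes N :: "('a \<Rightarrow> real) set" and m :: nat
  assumes M: "prob_space M" and "finite N"
    and meas: "\<And>g. g \<in> insert h N \<Longrightarrow> g \<in> borel_measurable M"
    and range: "\<And>g x. g \<in> insert h N \<Longrightarrow> g x \<in> {0, 1}"
    and g0: "g0 \<in> N" "(L2_nrm M (\<lambda>x. g0 x - h x))\<^sup>2 \<le> \<epsilon>"
    and sel: "\<And>X. X \<in> space (\<Pi>\<^sub>M i\<in>{..<m}. M) \<Longrightarrow> sel X \<in> N \<and>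
      (\<Sum>i<m. (sel X (X i) - h (X i))\<^sup>2) \<le> (\<Sum>i<m. (g0 (X i) - h (X i))\<^sup>2)"
  shows "(\<integral>\<^sup>+X. ennreal ((L2_nrm M (\<lambda>x. sel X x - h x))\<^sup>2) \<partial>(\<Pi>\<^sub>M i\<in>{..<m}. M))
    \<le> ennreal (4 * \<epsilon> + card N * exp (- (real m * \<epsilon>)))"
proof -
  interpret prob_space M by fact
  interpret product_sigma_finite "\<lambda>i::nat. M"
    by (intro product_sigma_finite.intro sigma_finite_measure_axioms)
  interpret P: prob_space "\<Pi>\<^sub>M i\<in>{..<m}. M"
    by (intro prob_space_PiM M)
  define D where "D g = (L2_nrm M (\<lambda>x. g x - h x))\<^sup>2" for g
  \<comment> \<open>The product of \<open>w g\<close> over the sample is 2 to the power of the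
    number of errors of \<open>g0\<close> minus the number of errors of \<open>g\<close>.\<close>
  define w where "w g x = 2 powr ((g0 x - h x)\<^sup>2 - (g x - h x)\<^sup>2)" for g x
  define B where "B = {g \<in> N. D g > 4 * \<epsilon>}"
  have "finite B" "B \<subseteq> N" using \<open>finite N\<close> by (auto simp: B_def)
  have "\<epsilon> \<ge> 0" using g0(2) zero_le_power2 order_trans by blast
  have [measurable]: "h \<in> borel_measurable M" "g0 \<in> borel_measurable M"
    using meas g0 by auto
  have sq: "(g x - h x)\<^sup>2 \<in> {0, 1}" if "g \<in> N" for g x
    using range[of g x] range[of h x] that by auto
  have sq_le: "(g x - h x)\<^sup>2 \<le> 1" if "g \<in> N" for g x
    using sq[OF that, of x] by auto
  have int: "integrable M (\<lambda>x. (g x - h x)\<^sup>2)" if "g \<in> N" for g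
  proof -
    have [measurable]: "g \<in> borel_measurable M" using that meas by auto
    show ?thesis
      using sq_le[OF that] by (intro integrable_const_bound[of _ 1] AE_I2) simp_all
  qed
  have D1: "D g \<le> 1" if "g \<in> N" for g
  proof -
    have "(\<integral>x. (g x - h x)\<^sup>2 \<partial>M) \<le> (\<integral>x. 1 \<partial>M)"
      using int[OF that] sq_le[OF that] by (intro integral_mono) simp_all
    then show ?thesis by (simp add: D_def L2_nrm_sq prob_space)
  qed
  have w: "(\<integral>\<^sup>+x. ennreal (w g x) \<partial>M) \<le> ennreal (exp (- \<epsilon>))" if "g \<in> B" for g
  proof -
    have g: "g \<in> N" "D g > 4 * \<epsilon>" using that by (auto simp: B_def)
    \<comment> \<open>Base 2 makes the exponential moment affine: \<open>2\<^bsup>u - v\<^esup> \<le> 1 + u - v / 2\<close> for \<open>u, v \<in> {0, 1}\<close>.\<close>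
    have "w g x \<le> 1 + (g0 x - h x)\<^sup>2 - (g x - h x)\<^sup>2 / 2" for x
      using sq[OF g(1), of x] sq[OF g0(1), of x] by (auto simp: w_def powr_minus)
    then have "(\<integral>\<^sup>+x. ennreal (w g x) \<partial>M)
        \<le> (\<integral>\<^sup>+x. ennreal (1 + (g0 x - h x)\<^sup>2 - (g x - h x)\<^sup>2 / 2) \<partial>M)"
      by (intro nn_integral_mono ennreal_leI)
    also have "\<dots> = ennreal (\<integral>x. 1 + (g0 x - h x)\<^sup>2 - (g x - h x)\<^sup>2 / 2 \<partial>M)"
    proof (rule nn_integral_eq_integral)
      show "integrable M (\<lambda>x. 1 + (g0 x - h x)\<^sup>2 - (g x - h x)\<^sup>2 / 2)"
        using int[OF g(1)] int[OF g0(1)] by simp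
      have "0 \<le> 1 + (g0 x - h x)\<^sup>2 - (g x - h x)\<^sup>2 / 2" for x
        using sq[OF g(1), of x] sq[OF g0(1), of x] by auto
      then show "AE x in M. 0 \<le> 1 + (g0 x - h x)\<^sup>2 - (g x - h x)\<^sup>2 / 2"
        by simp
    qed
    also have "(\<integral>x. 1 + (g0 x - h x)\<^sup>2 - (g x - h x)\<^sup>2 / 2 \<partial>M) = 1 + D g0 - D g / 2"
      using int[OF g(1)] int[OF g0(1)] by (simp add: D_def L2_nrm_sq prob_space)
    \<comment> \<open>Here the factor 4 in \<open>B\<close> enters:
      \<open>D g0 \<le> \<epsilon>\<close> and \<open>D g / 2 > 2 * \<epsilon>\<close> leave a gap
      of \<epsilon>.\<close>
    also have "\<dots> \<le> 1 - \<epsilon>"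
      using g0(2) g(2) by (simp add: D_def)
    also have "\<dots> \<le> exp (- \<epsilon>)"
      using exp_ge_add_one_self[of "- \<epsilon>"] by simp
    finally show ?thesis by (simp add: ennreal_leI)
  qed
  have pointwise: "ennreal (D (sel X)) \<le> ennreal (4 * \<epsilon>) + (\<Sum>g\<in>B. \<Prod>i<m. ennreal (w g (X i)))"
    if X: "X \<in> space (\<Pi>\<^sub>M i\<in>{..<m}. M)" for X
  proof (cases "sel X \<in> B")
    case True
    \<comment> \<open>The exponent is nonnegative because the selected function makes at most as
      many errors as \<open>g0\<close>.\<close>
    have "1 \<le> 2 powr ((\<Sum>i<m. (g0 (X i) - h (X i))\<^sup>2) - (\<Sum>i<m. (sel X (X i) - h (X i))\<^sup>2))"
      using sel[OF X] by (intro ge_one_powr_ge_zero) auto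
    also have "\<dots> = (\<Prod>i<m. w (sel X) (X i))"
      by (simp add: w_def powr_sum flip: sum_subtractf)
    finally have "ennreal 1 \<le> (\<Prod>i<m. ennreal (w (sel X) (X i)))"
      by (subst prod_ennreal) (auto simp: w_def intro!: ennreal_leI)
    also have "\<dots> \<le> (\<Sum>g\<in>B. \<Prod>i<m. ennreal (w g (X i)))"
      using \<open>finite B\<close> True by (intro member_le_sum) auto
    finally have "ennreal 1 \<le> (\<Sum>g\<in>B. \<Prod>i<m. ennreal (w g (X i)))" .
    moreover have "ennreal (D (sel X)) \<le> ennreal 1"
      using D1 sel[OF X] by (intro ennreal_leI) auto
    ultimately show ?thesis
      by (meson add_increasing order_trans zero_le)
  next
    case False
    then have "D (sel X) \<le> 4 * \<epsilon>" using sel[OF X] by (auto simp: B_def)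
    then show ?thesis by (simp add: ennreal_leI add_increasing2)
  qed
  have wm: "(\<lambda>x. ennreal (w g x)) \<in> borel_measurable M" if "g \<in> B" for g
  proof -
    have [measurable]: "g \<in> borel_measurable M" using that \<open>B \<subseteq> N\<close> meas by auto
    show ?thesis unfolding w_def by measurable
  qed
  have wpm: "(\<lambda>X. \<Prod>i<m. ennreal (w g (X i))) \<in> borel_measurable (\<Pi>\<^sub>M i\<in>{..<m}. M)" if "g \<in> B" for g
    by (intro borel_measurable_prod_ennreal measurable_compose[OF _ wm[OF that]]) simp
  \<comment> \<open>By independence of the sample points, the expectation of the product is a power
    of a single expectation.\<close>
  have wpow: "(\<integral>\<^sup>+X. (\<Prod>i<m. ennreal (w g (X i))) \<partial>(\<Pi>\<^sub>M i\<in>{..<m}. M))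
      = (\<integral>\<^sup>+x. ennreal (w g x) \<partial>M) ^ m" if "g \<in> B" for g
    using product_nn_integral_prod[of "{..<m}" "\<lambda>_ x. ennreal (w g x)"] wm[OF that] by simp
  have "(\<integral>\<^sup>+X. ennreal (D (sel X)) \<partial>(\<Pi>\<^sub>M i\<in>{..<m}. M))
      \<le> (\<integral>\<^sup>+X. ennreal (4 * \<epsilon>) + (\<Sum>g\<in>B. \<Prod>i<m. ennreal (w g (X i))) \<partial>(\<Pi>\<^sub>M i\<in>{..<m}. M))"
    by (intro nn_integral_mono pointwise)
  also have "\<dots> = ennreal (4 * \<epsilon>)
      + (\<Sum>g\<in>B. \<integral>\<^sup>+X. (\<Prod>i<m. ennreal (w g (X i))) \<partial>(\<Pi>\<^sub>M i\<in>{..<m}. M))"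
    using wpm by (simp add: nn_integral_add nn_integral_sum P.emeasure_space_1)
  also have "\<dots> = ennreal (4 * \<epsilon>) + (\<Sum>g\<in>B. (\<integral>\<^sup>+x. ennreal (w g x) \<partial>M) ^ m)"
    using wpow by simp
  also have "\<dots> \<le> ennreal (4 * \<epsilon>) + (\<Sum>g\<in>B. ennreal (exp (- \<epsilon>)) ^ m)"
    by (intro add_mono order_refl sum_mono power_mono w) auto
  also have "\<dots> \<le> ennreal (4 * \<epsilon>) + (\<Sum>g\<in>N. ennreal (exp (- \<epsilon>)) ^ m)"
    using \<open>finite N\<close> \<open>B \<subseteq> N\<close> by (intro add_mono order_refl sum_mono2) auto
  also have "\<dots> = ennreal (4 * \<epsilon> + card N * exp (- (real m * \<epsilon>)))"
    using \<open>\<epsilon> \<ge> 0\<close>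
    by (simp add: ennreal_power ennreal_of_nat_eq_real_of_nat ennreal_mult ennreal_plus
        flip: exp_of_nat_mult)
  finally show ?thesis by (simp add: D_def)
qed

text \<open>A measurable selection of a minimiser. The set \<open>G s\<close> of all minimisers has
  finitely many possible values, each attained on a measurable set of samples, and the selected
  function depends on \<open>s\<close> only through \<open>G s\<close>.\<close>

lemma finite_valued_estimator:
  assumes "finite N" "N \<subseteq> L2_functions (cube_measure d)"
    and meas: "\<And>g g'. g \<in> N \<Longrightarrow> g' \<in> N \<Longrightarrow>
      Measurable.pred (\<Pi>\<^sub>M i\<in>{..<m}. labelled_space d) (\<lambda>s. err g s \<le> (err g' s :: real))"
    and "N \<noteq> {}"
  obtains A where "A \<in> estimators d m" "\<And>s. A s \<in> N" "\<And>s g. g \<in> N \<Longrightarrow> err (A s) s \<le> err g s"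
proof -
  define S where "S = (\<Pi>\<^sub>M i\<in>{..<m}. labelled_space d)"
  note [measurable] = meas[folded S_def]
  define G where "G s = {g \<in> N. \<forall>g'\<in>N. err g s \<le> err g' s}" for s
  have G: "G \<in> S \<rightarrow>\<^sub>M count_space (Pow N)"
  proof (subst measurable_count_space_eq2)
    show "G \<in> space S \<rightarrow> Pow N \<and> (\<forall>Q\<in>Pow N. G -` {Q} \<inter> space S \<in> sets S)"
    proof (intro conjI ballI)
      show "G \<in> space S \<rightarrow> Pow N" by (auto simp: G_def)
      fix Q assume "Q \<in> Pow N"
      then have "G -` {Q} \<inter> space S
          = {s \<in> space S. \<forall>g\<in>N. (\<forall>g'\<in>N. err g s \<le> err g' s) \<longleftrightarrow> g \<in> Q}"
        unfolding G_def by blast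
      also have "\<dots> \<in> sets S"
        using \<open>finite N\<close> by measurable
      finally show "G -` {Q} \<inter> space S \<in> sets S" .
    qed
  qed (use \<open>finite N\<close> in simp)
  have ne: "G s \<noteq> {}" for s
  proof -
    have "Min ((\<lambda>g. err g s) ` N) \<in> (\<lambda>g. err g s) ` N"
      using assms by (intro Min_in) auto
    then obtain g where "g \<in> N" "err g s = Min ((\<lambda>g. err g s) ` N)" by auto
    then have "g \<in> G s" using \<open>finite N\<close> by (auto simp: G_def)
    then show ?thesis by auto
  qed
  \<comment> \<open>Maps out of a discrete space are measurable as soon as their values lie in the
    target. The value at the empty set only keeps \<open>pick\<close> inside \<open>N\<close> on all
    of \<open>Pow N\<close>; \<open>G s\<close> is never empty.\<close>
  define pick where "pick Q = (if Q = {} then SOME g. g \<in> N else SOME g. g \<in> Q)"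
    for Q :: "((nat \<Rightarrow> real) \<Rightarrow> real) set"
  have pick: "pick Q \<in> N" if "Q \<subseteq> N" for Q
    using that some_in_eq[of Q] some_in_eq[of N] \<open>N \<noteq> {}\<close> by (auto simp: pick_def)
  have "pick \<in> count_space (Pow N) \<rightarrow>\<^sub>M L2_space (cube_measure d)"
    using pick assms(2) by (auto simp: space_L2_space)
  from measurable_comp[OF G this] have "pick \<circ> G \<in> estimators d m"
    by (simp add: estimators_def S_def)
  moreover have "pick (G s) \<in> G s" for s
    using some_in_eq[of "G s"] ne[of s] by (simp add: pick_def)
  then have "(pick \<circ> G) s \<in> N" "g \<in> N \<Longrightarrow> err ((pick \<circ> G) s) s \<le> err g s" for s g
    by (auto simp: G_def)
  ultimately show ?thesis using that by blast
qed

section \<open>Counting typical label patterns\<close>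

text \<open>Such a set is the set of entries of a list of length exactly \<open>k\<close> over
  \<open>{..m}\<close>: list its elements and pad with the dummy entry \<open>m\<close>, which the
  intersection with \<open>{..<m}\<close> removes again.\<close>

lemma card_subsets_atMost_le:
  "card {S. S \<subseteq> {..<m::nat} \<and> card S \<le> k} \<le> (m + 1) ^ k"
proof -
  have "{S. S \<subseteq> {..<m} \<and> card S \<le> k}
      \<subseteq> (\<lambda>xs. set xs \<inter> {..<m}) ` {xs. set xs \<subseteq> {..m} \<and> length xs = k}"
  proof
    fix S assume "S \<in> {S. S \<subseteq> {..<m} \<and> card S \<le> k}"
    then have S: "S \<subseteq> {..<m}" "card S \<le> k" by auto
    then have "finite S" using finite_subset by blast
    then obtain xs where xs: "set xs = S" "length xs = card S"
      using finite_distinct_list distinct_card by metis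
    define ys where "ys = xs @ replicate (k - card S) m"
    have "length ys = k" "set ys \<subseteq> {..m}" "S = set ys \<inter> {..<m}"
      using S xs by (auto simp: ys_def)
    then show "S \<in> (\<lambda>xs. set xs \<inter> {..<m}) ` {xs. set xs \<subseteq> {..m} \<and> length xs = k}"
      by blast
  qed
  moreover have fin: "finite {xs. set xs \<subseteq> {..m} \<and> length xs = k}"
    by (intro finite_lists_length_eq) simp
  ultimately have "card {S. S \<subseteq> {..<m} \<and> card S \<le> k} \<le> card {xs. set xs \<subseteq> {..m} \<and> length xs = k}"
    by (meson card_image_le card_mono finite_imageI order_trans)
  also have "\<dots> = (m + 1) ^ k"
    by (simp add: card_lists_length_eq)
  finally show ?thesis .
qed

text \<open>A sample is determined by the approximating function and the positions of the errors.\<close>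

lemma card_samples_le:
  fixes P N :: "('a \<Rightarrow> real) set"
  assumes "finite N" "\<nu> ` P \<subseteq> N"
    and range: "\<And>g x. g \<in> P \<union> N \<Longrightarrow> g x \<in> {0, 1}"
  shows "card ((\<lambda>h. sample m h X) ` {h \<in> P. card {i \<in> {..<m}. h (X i) \<noteq> \<nu> h (X i)} \<le> k})
    \<le> card N * (m + 1) ^ k"
proof -
  define E where "E h = {i \<in> {..<m}. h (X i) \<noteq> \<nu> h (X i)}" for h
  \<comment> \<open>\<open>dec\<close> rebuilds a sample from the labels of \<open>g\<close> by
    flipping those at the positions in \<open>S\<close>; two different labels in
    \<open>{0, 1}\<close> are complements of each other.\<close>
  define dec where "dec = (\<lambda>(g, S). (\<lambda>i\<in>{..<m}. (X i, if i \<in> S then 1 - g (X i) else g (X i :: 'a) :: real)))"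
  let ?T = "{S. S \<subseteq> {..<m} \<and> card S \<le> k}"
  have fin: "finite (N \<times> ?T)"
    using \<open>finite N\<close> by (auto intro: finite_subset[of _ "Pow {..<m}"])
  have "sample m h X = dec (\<nu> h, E h)" if "h \<in> P" for h
  proof -
    have "h x = 1 - \<nu> h x" if "h x \<noteq> \<nu> h x" for x
      using range[of h x] range[of "\<nu> h" x] \<open>h \<in> P\<close> assms(2) that by auto
    then show ?thesis
      by (auto simp: sample_def dec_def E_def fun_eq_iff)
  qed
  then have "(\<lambda>h. sample m h X) ` {h \<in> P. card (E h) \<le> k} \<subseteq> dec ` (N \<times> ?T)"
    using assms(2) by (auto simp: E_def)
  then have "card ((\<lambda>h. sample m h X) ` {h \<in> P. card (E h) \<le> k}) \<le> card (N \<times> ?T)"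
    using fin by (meson card_image_le card_mono finite_imageI order_trans)
  also have "\<dots> \<le> card N * (m + 1) ^ k"
    using card_subsets_atMost_le[of m k] by (simp add: card_cartesian_product)
  finally show ?thesis by (simp add: E_def)
qed

text \<open>The expected number of errors is at most \<open>m * \<delta>\<close>, so Markov's
  inequality at twice this value gives probability at least 1/2.\<close>

lemma few_errors_prob:
  fixes M :: "'a measure" and m :: nat and \<delta> :: real
  assumes M: "prob_space M" and meas [measurable]: "h \<in> borel_measurable M" "g \<in> borel_measurable M"
    and range: "\<And>x. h x \<in> {0, 1}" "\<And>x. g x \<in> {0, 1}"
    and close: "(L2_nrm M (\<lambda>x. h x - g x))\<^sup>2 \<le> \<delta>" and "\<delta> > 0" "m > 0"
  defines "Q \<equiv> \<Pi>\<^sub>M i\<in>{..<m}. M"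
  defines "E \<equiv> {X \<in> space Q. card {i \<in> {..<m}. h (X i) \<noteq> g (X i)} \<le> nat \<lfloor>2 * m * \<delta>\<rfloor>}"
  shows "E \<in> sets Q" "1 / 2 \<le> measure Q E"
proof -
  interpret prob_space M by fact
  interpret Q: prob_space Q
    unfolding Q_def by (intro prob_space_PiM M)
  define c where "c X = (\<Sum>i<m. (h (X i) - g (X i))\<^sup>2)" for X
  have c: "c X = card {i \<in> {..<m}. h (X i) \<noteq> g (X i)}" for X
  proof -
    have "c X = (\<Sum>i<m. if h (X i) \<noteq> g (X i) then 1 else 0)"
      unfolding c_def
    proof (intro sum.cong refl)
      show "(h (X i) - g (X i))\<^sup>2 = (if h (X i) \<noteq> g (X i) then 1 else 0)" for i
        using range(1)[of "X i"] range(2)[of "X i"] by auto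
    qed
    also have "\<dots> = card {i \<in> {..<m}. h (X i) \<noteq> g (X i)}"
      by (simp add: sum.If_cases Int_def)
    finally show ?thesis .
  qed
  have comp: "(\<lambda>X. X i) \<in> Q \<rightarrow>\<^sub>M M" if "i < m" for i
    using that by (simp add: Q_def)
  have hgm: "(\<lambda>X. h (X i)) \<in> borel_measurable Q" "(\<lambda>X. g (X i)) \<in> borel_measurable Q" if "i < m" for i
    by (rule measurable_compose[OF comp[OF that] meas(1)], rule measurable_compose[OF comp[OF that] meas(2)])
  have cm [measurable]: "c \<in> borel_measurable Q"
    unfolding c_def by (intro borel_measurable_sum borel_measurable_power borel_measurable_diff hgm) simp_all
  have E: "E = {X \<in> space Q. c X \<le> real (nat \<lfloor>2 * m * \<delta>\<rfloor>)}"
    by (simp add: E_def c)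
  show "E \<in> sets Q" unfolding E by measurable
  have sq_le: "(h x - g x)\<^sup>2 \<le> 1" for x
    using range(1)[of x] range(2)[of x] by auto
  have int1: "integrable M (\<lambda>x. (h x - g x)\<^sup>2)"
    using sq_le by (intro integrable_const_bound[of _ 1] AE_I2) simp_all
  have distr: "distr Q M (\<lambda>X. X i) = M" if "i < m" for i
    unfolding Q_def using that M by (intro distr_PiM_component) auto
  have int: "integrable Q (\<lambda>X. (h (X i) - g (X i))\<^sup>2)"
    "(\<integral>X. (h (X i) - g (X i))\<^sup>2 \<partial>Q) \<le> \<delta>" if i: "i < m" for i
  proof -
    have "integrable (distr Q M (\<lambda>X. X i)) (\<lambda>x. (h x - g x)\<^sup>2)"
      using int1 distr[OF i] by simp
    then show "integrable Q (\<lambda>X. (h (X i) - g (X i))\<^sup>2)"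
      using comp[OF i] by (simp add: integrable_distr_eq)
    have "(\<integral>X. (h (X i) - g (X i))\<^sup>2 \<partial>Q) = (\<integral>x. (h x - g x)\<^sup>2 \<partial>distr Q M (\<lambda>X. X i))"
      using comp[OF i] by (simp add: integral_distr)
    then show "(\<integral>X. (h (X i) - g (X i))\<^sup>2 \<partial>Q) \<le> \<delta>"
      using close distr[OF i] by (simp add: L2_nrm_sq)
  qed
  have intc: "integrable Q c"
    unfolding c_def using int by (intro Bochner_Integration.integrable_sum) auto
  have "(\<integral>X. c X \<partial>Q) = (\<Sum>i<m. \<integral>X. (h (X i) - g (X i))\<^sup>2 \<partial>Q)"
    unfolding c_def using int by (intro Bochner_Integration.integral_sum) auto
  also have "\<dots> \<le> m * \<delta>"
    using sum_mono[of "{..<m}" "\<lambda>i. \<integral>X. (h (X i) - g (X i))\<^sup>2 \<partial>Q" "\<lambda>_. \<delta>"] int by simp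
  finally have "(\<integral>X. c X \<partial>Q) \<le> m * \<delta>" .
  have "measure Q {X \<in> space Q. c X \<ge> 2 * m * \<delta>} \<le> (\<integral>X. c X \<partial>Q) / (2 * m * \<delta>)"
    using \<open>\<delta> > 0\<close> \<open>m > 0\<close>
    by (intro integral_Markov_inequality_measure[where A = "space Q"] intc AE_I2) (auto simp: c)
  also have "\<dots> \<le> 1 / 2"
    using \<open>(\<integral>X. c X \<partial>Q) \<le> m * \<delta>\<close> \<open>\<delta> > 0\<close> \<open>m > 0\<close> by (simp add: field_simps)
  finally have "measure Q {X \<in> space Q. c X \<ge> 2 * m * \<delta>} \<le> 1 / 2" .
  \<comment> \<open>Rounding down costs nothing: an integer above the floor of
    \<open>2 * m * \<delta>\<close> exceeds \<open>2 * m * \<delta>\<close> itself.\<close>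
  moreover have "space Q - E \<subseteq> {X \<in> space Q. c X \<ge> 2 * m * \<delta>}"
  proof
    fix X assume X: "X \<in> space Q - E"
    then have "nat \<lfloor>2 * m * \<delta>\<rfloor> < card {i \<in> {..<m}. h (X i) \<noteq> g (X i)}"
      by (auto simp: E_def)
    then have "2 * m * \<delta> < c X"
      unfolding c by linarith
    with X show "X \<in> {X \<in> space Q. c X \<ge> 2 * m * \<delta>}" by simp
  qed
  then have "measure Q (space Q - E) \<le> measure Q {X \<in> space Q. c X \<ge> 2 * m * \<delta>}"
    using cm by (intro Q.finite_measure_mono) measurable
  ultimately show "1 / 2 \<le> measure Q E"
    using Q.prob_compl[OF \<open>E \<in> sets Q\<close>] by simp
qed

text \<open>The supremum is bounded below by the average over \<open>P\<close>. Fix the sample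
  points \<open>X\<close>. Of the functions that are typical for \<open>X\<close>, meaning
  \<open>X \<in> E h\<close>, at most \<open>L \<le> card P / 4\<close> have loss at most
  \<open>\<epsilon> / 4\<close>, because they have pairwise different samples. All other typical
  functions have loss above \<open>\<epsilon> / 4\<close>, and each function is typical with
  probability at least 1/2.\<close>

lemma sup_risk_lower_bound:
  fixes M :: "'a measure" and P N :: "('a \<Rightarrow> real) set" and m :: nat and \<delta> \<epsilon> :: real
  assumes M: "prob_space M" and fin: "finite P" "P \<noteq> {}" "finite N" and "\<nu> ` P \<subseteq> N"
    and meas: "\<And>g. g \<in> P \<union> N \<Longrightarrow> g \<in> borel_measurable M"
    and range: "\<And>g x. g \<in> P \<union> N \<Longrightarrow> g x \<in> {0, 1}"
    and close: "\<And>h. h \<in> P \<Longrightarrow> (L2_nrm M (\<lambda>x. h x - \<nu> h x))\<^sup>2 \<le> \<delta>"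
    and sep: "\<And>h h'. h \<in> P \<Longrightarrow> h' \<in> P \<Longrightarrow> h \<noteq> h' \<Longrightarrow> \<epsilon> < (L2_nrm M (\<lambda>x. h x - h' x))\<^sup>2"
    and pos: "\<delta> > 0" "m > 0" "\<epsilon> > 0"
    and A: "\<And>h X. h \<in> P \<Longrightarrow> X \<in> space (\<Pi>\<^sub>M i\<in>{..<m}. M) \<Longrightarrow> A (sample m h X) \<in> L2_functions M"
    and A_meas: "\<And>h. h \<in> P \<Longrightarrow> (\<lambda>X. (L2_nrm M (\<lambda>x. A (sample m h X) x - h x))\<^sup>2)
      \<in> borel_measurable (\<Pi>\<^sub>M i\<in>{..<m}. M)"
    and card: "4 * (card N * (m + 1) ^ nat \<lfloor>2 * m * \<delta>\<rfloor>) \<le> card P"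
  shows "ennreal (\<epsilon> / 16) \<le>
    (SUP h\<in>P. \<integral>\<^sup>+X. ennreal ((L2_nrm M (\<lambda>x. A (sample m h X) x - h x))\<^sup>2) \<partial>(\<Pi>\<^sub>M i\<in>{..<m}. M))"
    (is "_ \<le> ?s")
proof -
  define Q where "Q = (\<Pi>\<^sub>M i\<in>{..<m}. M)"
  interpret prob_space M by fact
  interpret Q: prob_space Q
    unfolding Q_def by (intro prob_space_PiM M)
  define k where "k = nat \<lfloor>2 * m * \<delta>\<rfloor>"
  define L where "L = card N * (m + 1) ^ k"
  define E where "E h = {X \<in> space Q. card {i \<in> {..<m}. h (X i) \<noteq> \<nu> h (X i)} \<le> k}" for h
  define l where "l h X = (L2_nrm M (\<lambda>x. A (sample m h X) x - h x))\<^sup>2" for h X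
  have E: "E h \<in> sets Q" "1 / 2 \<le> measure Q (E h)" if "h \<in> P" for h
  proof -
    have "h \<in> P \<union> N" "\<nu> h \<in> P \<union> N" using that \<open>\<nu> ` P \<subseteq> N\<close> by auto
    note m = this[THEN meas] and r = this[THEN range]
    show "E h \<in> sets Q"
      unfolding E_def Q_def k_def
      by (rule few_errors_prob(1)[OF M m r close[OF that] pos(1,2)])
    show "1 / 2 \<le> measure Q (E h)"
      unfolding E_def Q_def k_def
      by (rule few_errors_prob(2)[OF M m r close[OF that] pos(1,2)])
  qed
  have L2: "h \<in> L2_functions M" if "h \<in> P" for h
    using that meas range by (intro zero_one_valued_L2_functions M) auto
  have count: "card {h \<in> P. X \<in> E h \<and> l h X \<le> \<epsilon> / 4} \<le> L" if X: "X \<in> space Q" for X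
  proof -
    let ?G = "{h \<in> P. X \<in> E h \<and> l h X \<le> \<epsilon> / 4}"
    \<comment> \<open>Equal samples lead to the same estimate \<open>f\<close>. If \<open>f\<close>
      is within squared distance \<open>\<epsilon> / 4\<close> of both functions, then their squared
      distance is at most \<epsilon>, against the separation of \<open>P\<close>.\<close>
    have "inj_on (\<lambda>h. sample m h X) ?G"
    proof (rule inj_onI, rule ccontr)
      fix h h' assume h: "h \<in> ?G" "h' \<in> ?G" "sample m h X = sample m h' X" "h \<noteq> h'"
      define f where "f = A (sample m h X)"
      have "f \<in> L2_functions M" using A h X by (auto simp: f_def Q_def)
      have "(L2_nrm M (\<lambda>x. (f x - h' x) - (f x - h x)))\<^sup>2
          \<le> (1 + 1) * (L2_nrm M (\<lambda>x. f x - h' x))\<^sup>2 + (1 + 1 / 1) * (L2_nrm M (\<lambda>x. f x - h x))\<^sup>2"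
        using h L2 \<open>f \<in> L2_functions M\<close> by (intro L2_nrm_sq_add_le L2_functions_diff) auto
      also have "\<dots> = 2 * l h' X + 2 * l h X"
        by (simp add: l_def f_def flip: h(3))
      also have "\<dots> \<le> \<epsilon>"
        using h(1,2) by simp
      finally show False
        using sep[of h h'] h by simp
    qed
    then have "card ?G = card ((\<lambda>h. sample m h X) ` ?G)"
      by (simp add: card_image)
    also have "\<dots> \<le> card ((\<lambda>h. sample m h X) ` {h \<in> P. card {i \<in> {..<m}. h (X i) \<noteq> \<nu> h (X i)} \<le> k})"
      using fin by (intro card_mono image_mono) (auto simp: E_def)
    also have "\<dots> \<le> L"
      unfolding L_def using fin \<open>\<nu> ` P \<subseteq> N\<close> range by (intro card_samples_le) auto
    finally show ?thesis .
  qed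
  \<comment> \<open>Each typical function contributes \<open>\<epsilon> / 4\<close> on the left. Its
    loss pays for this unless it is one of the at most \<open>L\<close> well estimated ones.\<close>
  have pointwise: "(\<Sum>h\<in>P. ennreal (\<epsilon> / 4) * indicator (E h) X)
      \<le> (\<Sum>h\<in>P. ennreal (l h X)) + ennreal (\<epsilon> / 4 * L)" if X: "X \<in> space Q" for X
  proof -
    have "(\<Sum>h\<in>P. \<epsilon> / 4 * indicator (E h) X)
        \<le> (\<Sum>h\<in>P. l h X + \<epsilon> / 4 * (if X \<in> E h \<and> l h X \<le> \<epsilon> / 4 then 1 else 0))"
      using \<open>\<epsilon> > 0\<close> by (intro sum_mono) (auto simp: l_def indicator_def)
    also have "\<dots> = (\<Sum>h\<in>P. l h X) + \<epsilon> / 4 * card {h \<in> P. X \<in> E h \<and> l h X \<le> \<epsilon> / 4}"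
    proof -
      have "card {h \<in> P. X \<in> E h \<and> l h X \<le> \<epsilon> / 4} = (\<Sum>h\<in>P. if X \<in> E h \<and> l h X \<le> \<epsilon> / 4 then 1 else 0::real)"
        using fin by (simp only: sum.If_cases Int_def) simp
      then show ?thesis by (simp only: sum.distrib sum_distrib_left)
    qed
    also have "\<dots> \<le> (\<Sum>h\<in>P. l h X) + \<epsilon> / 4 * L"
      using count[OF X] \<open>\<epsilon> > 0\<close> by (intro add_left_mono mult_left_mono) auto
    finally have "ennreal (\<Sum>h\<in>P. \<epsilon> / 4 * indicator (E h) X) \<le> ennreal ((\<Sum>h\<in>P. l h X) + \<epsilon> / 4 * L)"
      by (rule ennreal_leI)
    also have "\<dots> = (\<Sum>h\<in>P. ennreal (l h X)) + ennreal (\<epsilon> / 4 * L)"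
      using \<open>\<epsilon> > 0\<close> by (subst ennreal_plus) (auto simp: l_def intro!: sum_nonneg)
    also have "ennreal (\<Sum>h\<in>P. \<epsilon> / 4 * indicator (E h) X) = (\<Sum>h\<in>P. ennreal (\<epsilon> / 4 * indicator (E h) X))"
      using \<open>\<epsilon> > 0\<close> by (intro sum_ennreal[symmetric]) simp
    also have "\<dots> = (\<Sum>h\<in>P. ennreal (\<epsilon> / 4) * indicator (E h) X)"
      by (intro sum.cong refl) (simp split: split_indicator)
    finally show ?thesis .
  qed
  have lm: "(\<lambda>X. ennreal (l h X)) \<in> borel_measurable Q" if "h \<in> P" for h
    using A_meas[OF that] unfolding l_def Q_def by measurable
  \<comment> \<open>Integrate the pointwise bound. Since \<open>measure Q (E h) \<ge> 1 / 2\<close>,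
    the left side keeps \<open>\<epsilon> / 8\<close> per function, and by
    \<open>4 * L \<le> card P\<close> the correction is at most \<open>\<epsilon> / 16\<close> per
    function.\<close>
  have "ennreal (card P * (\<epsilon> / 8)) = (\<Sum>h\<in>P. ennreal (\<epsilon> / 8))"
    using \<open>\<epsilon> > 0\<close> by (simp add: ennreal_of_nat_eq_real_of_nat flip: ennreal_mult)
  also have "\<dots> \<le> (\<Sum>h\<in>P. ennreal (\<epsilon> / 4) * emeasure Q (E h))"
  proof (rule sum_mono)
    fix h assume "h \<in> P"
    have "\<epsilon> / 8 \<le> \<epsilon> / 4 * measure Q (E h)"
      using E(2)[OF \<open>h \<in> P\<close>] \<open>\<epsilon> > 0\<close> by simp
    then show "ennreal (\<epsilon> / 8) \<le> ennreal (\<epsilon> / 4) * emeasure Q (E h)"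
      using \<open>\<epsilon> > 0\<close> by (simp add: Q.emeasure_eq_measure ennreal_leI flip: ennreal_mult)
  qed
  also have "\<dots> = (\<integral>\<^sup>+X. (\<Sum>h\<in>P. ennreal (\<epsilon> / 4) * indicator (E h) X) \<partial>Q)"
    using E(1) by (simp add: nn_integral_sum nn_integral_cmult_indicator)
  also have "\<dots> \<le> (\<integral>\<^sup>+X. (\<Sum>h\<in>P. ennreal (l h X)) + ennreal (\<epsilon> / 4 * L) \<partial>Q)"
    by (intro nn_integral_mono pointwise)
  also have "\<dots> = (\<Sum>h\<in>P. \<integral>\<^sup>+X. ennreal (l h X) \<partial>Q) + ennreal (\<epsilon> / 4 * L)"
    using lm by (simp add: nn_integral_add nn_integral_sum Q.emeasure_space_1)
  also have "\<dots> \<le> (\<Sum>h\<in>P. ?s) + ennreal (card P * (\<epsilon> / 16))"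
  proof (intro add_mono sum_mono ennreal_leI)
    show "(\<integral>\<^sup>+X. ennreal (l h X) \<partial>Q) \<le> ?s" if "h \<in> P" for h
      using that unfolding l_def Q_def by (rule SUP_upper)
    have "4 * real L \<le> card P"
      using card unfolding L_def k_def by (metis of_nat_le_iff of_nat_mult of_nat_numeral)
    then show "\<epsilon> / 4 * real L \<le> real (card P) * (\<epsilon> / 16)"
      using mult_right_mono[of "4 * real L" "card P" "\<epsilon> / 16"] \<open>\<epsilon> > 0\<close> by simp
  qed
  finally have *: "ennreal (card P * (\<epsilon> / 8)) \<le> of_nat (card P) * ?s + ennreal (card P * (\<epsilon> / 16))"
    by simp
  show ?thesis
  \<comment> \<open>Cancelling the correction and \<open>card P\<close> is done in the reals, hence
    for a finite supremum; an infinite one satisfies the bound trivially.\<close>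
  proof (cases ?s)
    case (real r)
    have "card P > 0" using fin by (simp add: card_gt_0_iff)
    have "ennreal (card P * (\<epsilon> / 8)) \<le> ennreal (card P * r + card P * (\<epsilon> / 16))"
      using * \<open>r \<ge> 0\<close> \<open>\<epsilon> > 0\<close> unfolding real
      by (simp add: ennreal_of_nat_eq_real_of_nat ennreal_mult ennreal_plus)
    then have "card P * (\<epsilon> / 8) \<le> card P * (r + \<epsilon> / 16)"
      using \<open>r \<ge> 0\<close> \<open>\<epsilon> > 0\<close> by (subst (asm) ennreal_le_iff) (auto simp: algebra_simps)
    then have "\<epsilon> / 8 \<le> r + \<epsilon> / 16"
      using \<open>card P > 0\<close> by (simp only: mult_le_cancel_left_pos of_nat_0_less_iff)
    then show ?thesis unfolding real by (intro ennreal_leI) simp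
  next
    case top
    then show ?thesis by (simp only: top_greatest)
  qed
qed

section \<open>Balancing the rates\<close>

text \<open>This is \<open>ln x \<le> x - 1\<close> at \<open>x = y / (2 * \<beta>)\<close>. It lets
  the exponential term of the upper bound be absorbed in the rate
  \<open>y powr (- \<beta>)\<close>.\<close>

lemma powr_le_exp_half:
  assumes "\<beta> > 0" "y > (0::real)"
  shows "y powr \<beta> \<le> (2 * \<beta>) powr \<beta> * exp (y / 2)"
proof -
  have "ln (y / (2 * \<beta>)) \<le> y / (2 * \<beta>)"
    using ln_le_minus_one[of "y / (2 * \<beta>)"] assms by simp
  then have "\<beta> * ln y \<le> \<beta> * ln (2 * \<beta>) + y / 2"
    using assms by (simp add: ln_div field_simps)
  then have "exp (\<beta> * ln y) \<le> exp (\<beta> * ln (2 * \<beta>) + y / 2)" by simp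
  then show ?thesis
    using assms by (simp add: powr_def exp_add)
qed

text \<open>Exponentials outgrow powers. In the lower bound \<epsilon> carries a constant factor
  \<open>exp (- z)\<close>: it multiplies the entropy by \<open>exp (z / \<alpha>)\<close>, but
  enters the logarithmic factor only through \<open>S + 2 * z\<close>. So the constant can be taken
  small enough.\<close>

lemma powr_affine_le_exp:
  fixes K c \<alpha> a S Z :: real
  assumes "K > 0" "c > 0" "\<alpha> > 0" "a \<ge> 0" "S > 0"
  obtains z where "K * (S + 2 * z) powr a \<le> c * exp (z / \<alpha>)" "z > Z"
proof -
  define k where "k = nat \<lceil>a\<rceil>"
  \<comment> \<open>With \<open>z = \<alpha> * x\<close> and \<open>x \<ge> 1\<close>, the affine
    term \<open>S + 2 * z\<close> is at most \<open>M * x\<close>.\<close>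
  define M where "M = S + 2 * \<alpha>"
  have "M > 0" using assms by (simp add: M_def)
  then have "0 < c / (K * M powr a)" using assms by simp
  then have "\<forall>\<^sub>F x in at_top. x ^ k / exp x < c / (K * M powr a)"
    by (rule order_tendstoD(2)[OF tendsto_power_div_exp_0])
  then have "\<forall>\<^sub>F x in at_top. x ^ k / exp x < c / (K * M powr a) \<and> 1 \<le> x \<and> Z / \<alpha> < x"
    by (intro eventually_conj eventually_ge_at_top eventually_gt_at_top)
  then obtain x where x: "x ^ k / exp x < c / (K * M powr a)" "1 \<le> x" "Z / \<alpha> < x"
    using eventually_happens'[OF trivial_limit_at_top_linorder] by blast
  have "S * 1 \<le> S * x" using x(2) assms by (intro mult_left_mono) auto
  then have "S + 2 * (\<alpha> * x) \<le> M * x" by (simp add: M_def algebra_simps)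
  then have "(S + 2 * (\<alpha> * x)) powr a \<le> (M * x) powr a"
    using assms x(2) by (intro powr_mono2) auto
  also have "\<dots> = M powr a * x powr a"
    using \<open>M > 0\<close> x(2) by (simp add: powr_mult)
  also have "x powr a \<le> x powr real k"
    using x(2) \<open>a \<ge> 0\<close> by (intro powr_mono) (auto simp: k_def real_nat_ceiling_ge)
  also have "x powr real k = x ^ k" using x(2) by (simp add: powr_realpow)
  finally have "K * (S + 2 * (\<alpha> * x)) powr a \<le> K * (M powr a * x ^ k)"
    using \<open>K > 0\<close> by (simp add: mult_left_mono)
  also have "\<dots> \<le> c * exp x"
    using x(1) \<open>K > 0\<close> \<open>M > 0\<close> by (simp add: field_simps)
  finally show ?thesis
    using that[of "\<alpha> * x"] x(3) \<open>\<alpha> > 0\<close> by (simp add: field_simps)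
qed

text \<open>Compares powers of \<open>l = ln (2 * m)\<close>, which can be as small as
  \<open>ln 2 < 1\<close>; a larger exponent therefore gives a larger power only up to a
  constant.\<close>

lemma powr_mono_from_ln2:
  fixes l p q :: real
  assumes "ln 2 \<le> l" "p \<le> q"
  shows "l powr p \<le> ln 2 powr (p - q) * l powr q"
proof -
  have "l > 0" using assms(1) ln_gt_zero[of "2::real"] by linarith
  have "l powr p = l powr (p - q) * l powr q"
    using \<open>l > 0\<close> by (simp flip: powr_add)
  also have "\<dots> \<le> ln 2 powr (p - q) * l powr q"
    using assms by (intro mult_right_mono powr_mono2') auto
  finally show ?thesis .
qed

text \<open>The scale \<epsilon> is a constant times \<open>m powr (- \<beta> / (\<beta> + 1)) * ln
  (2 * m) powr \<gamma>\<close>, at which the entropy is at most half of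
  \<open>m * \<epsilon>\<close>. If this is not below 1, the first alternative holds, for which the
  trivial bound on the risk suffices. The exponent \<gamma> is at most the stated \<tau>.\<close>

lemma upper_rate:
  fixes \<beta> b c :: real
  assumes "\<beta> > 0" "b \<ge> 0" "c > 0"
  obtains C where "C > 0" "\<And>m::nat. m \<ge> 1 \<Longrightarrow>
      1 \<le> C * real m powr (- \<beta> / (\<beta> + 1)) * ln (2 * real m) powr ((2 + \<beta> * b) / (\<beta> + 1)) \<or>
      (\<exists>\<epsilon>>0. \<epsilon> < 1 \<and>
        4 * \<epsilon> + exp (c * (\<epsilon> powr (- 1 / \<beta>) * ln (2 + 1 / \<epsilon>) powr b) - real m * \<epsilon>)
          \<le> C * real m powr (- \<beta> / (\<beta> + 1)) * ln (2 * real m) powr ((2 + \<beta> * b) / (\<beta> + 1)))"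
proof -
  \<comment> \<open>\<gamma> solves \<open>b - \<gamma> / \<beta> = \<gamma>\<close>, so the bound
    on the entropy and \<open>m * \<epsilon>\<close> carry the same power of the logarithm.\<close>
  define \<gamma> where "\<gamma> = \<beta> * b / (\<beta> + 1)"
  define \<tau> where "\<tau> = (2 + \<beta> * b) / (\<beta> + 1)"
  \<comment> \<open>The first summand makes \<open>D * l powr \<gamma> \<ge> 1\<close>, hence
    \<open>m * \<epsilon> \<ge> y\<close>; the second makes the entropy at most
    \<open>m * \<epsilon> / 2\<close>; the third makes \<open>D \<ge> 1\<close>.\<close>
  define D where "D = ln 2 powr (- \<gamma>) + 2 * c * 2 powr b + (1::real)"
  \<comment> \<open>The two summands account for \<open>4 * \<epsilon>\<close> and for the
    exponential term, both in units of \<open>e\<close>.\<close>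
  define K where "K = 4 * D + (2 * \<beta>) powr \<beta> * ln 2 powr (- \<gamma>)"
  define C where "C = K * ln 2 powr (\<gamma> - \<tau>)"
  have "\<gamma> \<le> \<tau>"
    using assms unfolding \<gamma>_def \<tau>_def by (intro divide_right_mono) auto
  have "\<gamma> \<ge> 0" using assms by (simp add: \<gamma>_def)
  have "\<gamma> * (\<beta> + 1) = \<beta> * b" using assms by (simp add: \<gamma>_def)
  then have \<gamma>_balance: "- \<gamma> / \<beta> + b = \<gamma>" using assms by (simp add: field_simps)
  have "D \<ge> 1" "D \<ge> ln 2 powr (- \<gamma>)" "D \<ge> 2 * c * 2 powr b"
    using assms by (auto simp: D_def add_increasing add_increasing2)
  have "K \<ge> D" "K > 0" using \<open>D \<ge> 1\<close> by (auto simp: K_def add_pos_nonneg add_increasing2)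
  then have "C > 0" by (simp add: C_def)
  moreover have "1 \<le> C * real m powr (- \<beta> / (\<beta> + 1)) * ln (2 * real m) powr \<tau> \<or>
      (\<exists>\<epsilon>>0. \<epsilon> < 1 \<and>
        4 * \<epsilon> + exp (c * (\<epsilon> powr (- 1 / \<beta>) * ln (2 + 1 / \<epsilon>) powr b) - real m * \<epsilon>)
          \<le> C * real m powr (- \<beta> / (\<beta> + 1)) * ln (2 * real m) powr \<tau>)" if "m \<ge> 1" for m :: nat
  proof -
    \<comment> \<open>With \<open>m = y powr (\<beta> + 1)\<close> the rates become integral
      multiples of \<beta> or 1 in the exponent of \<open>y\<close>.\<close>
    define y where "y = real m powr (1 / (\<beta> + 1))"
    define l where "l = ln (2 * real m)"
    define e where "e = y powr (- \<beta>) * l powr \<gamma>"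
    define \<epsilon> where "\<epsilon> = D * e"
    have "y \<ge> 1" using that assms by (simp add: y_def ge_one_powr_ge_zero)
    have m: "real m = y * y powr \<beta>"
      using that assms by (simp add: y_def powr_powr flip: powr_add) (simp add: field_simps)
    have l2: "ln 2 \<le> l" using that by (simp add: l_def)
    then have "l > 0" using ln_gt_zero[of "2::real"] by linarith
    have mp: "real m powr (- \<beta> / (\<beta> + 1)) = y powr (- \<beta>)"
      by (simp add: y_def powr_powr)
    have "e > 0" using \<open>l > 0\<close> \<open>y \<ge> 1\<close> by (simp add: e_def)
    then have "\<epsilon> > 0" using \<open>D \<ge> 1\<close> by (simp add: \<epsilon>_def)
    have "K * e \<le> K * (y powr (- \<beta>) * (ln 2 powr (\<gamma> - \<tau>) * l powr \<tau>))"
      unfolding e_def using powr_mono_from_ln2[OF l2 \<open>\<gamma> \<le> \<tau>\<close>] \<open>K > 0\<close> by (intro mult_left_mono) auto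
    then have Ke: "K * e \<le> C * real m powr (- \<beta> / (\<beta> + 1)) * l powr \<tau>"
      unfolding mp by (simp add: C_def mult_ac)
    show ?thesis
    proof (cases "\<epsilon> < 1")
      case False
      then have "1 \<le> K * e"
      proof -
        have "D * e \<le> K * e" using \<open>K \<ge> D\<close> \<open>e > 0\<close> by (intro mult_right_mono) auto
        then show ?thesis using False unfolding \<epsilon>_def by linarith
      qed
      then show ?thesis using Ke by (simp add: l_def)
    next
      case True
      have me: "real m * \<epsilon> = D * y * l powr \<gamma>"
        using \<open>y \<ge> 1\<close> by (simp add: \<epsilon>_def e_def m powr_minus field_simps)
      have Dl: "1 \<le> D * l powr \<gamma>"
      proof -
        have "1 = ln 2 powr (- \<gamma>) * ln 2 powr \<gamma>"
          by (simp flip: powr_add)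
        also have "\<dots> \<le> D * l powr \<gamma>"
          using \<open>D \<ge> ln 2 powr (- \<gamma>)\<close> l2 \<open>\<gamma> \<ge> 0\<close> \<open>D \<ge> 1\<close> by (intro mult_mono powr_mono2) auto
        finally show ?thesis .
      qed
      have "y * 1 \<le> y * (D * l powr \<gamma>)"
        using Dl \<open>y \<ge> 1\<close> by (intro mult_left_mono) auto
      then have mey: "real m * \<epsilon> \<ge> y" unfolding me by (simp add: mult_ac)
      then have "1 / \<epsilon> \<le> m"
        using \<open>y \<ge> 1\<close> \<open>\<epsilon> > 0\<close> by (simp add: field_simps)
      have "ln (2 + 1 / \<epsilon>) \<le> ln ((2 * real m) ^ 2)"
      proof (subst ln_le_cancel_iff)
        have "real m \<le> real m * real m" using that by simp
        moreover have "1 \<le> real m" using that by simp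
        ultimately have "2 + 1 / \<epsilon> \<le> 4 * (real m * real m)"
          using \<open>1 / \<epsilon> \<le> m\<close> by linarith
        then show "2 + 1 / \<epsilon> \<le> (2 * real m) ^ 2"
          by (simp add: power2_eq_square)
      qed (use \<open>\<epsilon> > 0\<close> that in \<open>auto intro: add_pos_pos\<close>)
      also have "\<dots> = 2 * l" using that unfolding l_def by (subst ln_realpow) auto
      finally have "ln (2 + 1 / \<epsilon>) powr b \<le> (2 * l) powr b"
        using \<open>b \<ge> 0\<close> \<open>\<epsilon> > 0\<close> by (intro powr_mono2) auto
      then have "c * (\<epsilon> powr (- 1 / \<beta>) * ln (2 + 1 / \<epsilon>) powr b)
          \<le> c * (\<epsilon> powr (- 1 / \<beta>) * (2 * l) powr b)"
        using \<open>c > 0\<close> by (intro mult_left_mono) auto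
      also have "\<dots> = c * 2 powr b * D powr (- 1 / \<beta>) * y * (l powr (- \<gamma> / \<beta>) * l powr b)"
        using \<open>D \<ge> 1\<close> \<open>y \<ge> 1\<close> \<open>\<beta> > 0\<close> \<open>l > 0\<close>
        by (simp add: \<epsilon>_def e_def powr_mult powr_powr mult_ac)
      also have "l powr (- \<gamma> / \<beta>) * l powr b = l powr \<gamma>"
        unfolding powr_add[symmetric] using \<gamma>_balance by simp
      also have "c * 2 powr b * D powr (- 1 / \<beta>) * y * l powr \<gamma> \<le> D / 2 * 1 * y * l powr \<gamma>"
      proof -
        have "D powr (- 1 / \<beta>) \<le> D powr 0"
          using \<open>D \<ge> 1\<close> \<open>\<beta> > 0\<close> by (intro powr_mono) auto
        then show ?thesis
          using \<open>D \<ge> 2 * c * 2 powr b\<close> \<open>D \<ge> 1\<close> \<open>y \<ge> 1\<close> \<open>c > 0\<close>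
          by (intro mult_mono) auto
      qed
      also have "\<dots> = real m * \<epsilon> / 2" by (simp add: me)
      finally have "exp (c * (\<epsilon> powr (- 1 / \<beta>) * ln (2 + 1 / \<epsilon>) powr b) - real m * \<epsilon>) \<le> exp (- (y / 2))"
        using mey by simp
      also have "\<dots> \<le> (2 * \<beta>) powr \<beta> * ln 2 powr (- \<gamma>) * e"
      proof -
        have "y powr \<beta> \<le> (2 * \<beta>) powr \<beta> * exp (y / 2)"
          using \<open>\<beta> > 0\<close> \<open>y \<ge> 1\<close> by (intro powr_le_exp_half) auto
        then have "exp (- (y / 2)) \<le> (2 * \<beta>) powr \<beta> * y powr (- \<beta>)"
          using \<open>y \<ge> 1\<close> by (simp add: exp_minus powr_minus field_simps)
        also have "\<dots> * 1 \<le> (2 * \<beta>) powr \<beta> * y powr (- \<beta>) * (ln 2 powr (- \<gamma>) * l powr \<gamma>)"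
          using powr_mono_from_ln2[OF l2 \<open>\<gamma> \<ge> 0\<close>] \<open>l > 0\<close> by (intro mult_left_mono) auto
        finally show ?thesis by (simp add: e_def mult_ac)
      qed
      finally have "4 * \<epsilon> + exp (c * (\<epsilon> powr (- 1 / \<beta>) * ln (2 + 1 / \<epsilon>) powr b) - real m * \<epsilon>) \<le> K * e"
        by (simp add: K_def \<epsilon>_def algebra_simps)
      then show ?thesis using Ke True \<open>\<epsilon> > 0\<close> unfolding l_def by (meson order_trans)
    qed
  qed
  ultimately show ?thesis using that unfolding \<tau>_def by blast
qed

text \<open>Both \<open>ln y\<close> and \<open>\<bar>ln l\<bar>\<close> are at most a multiple of
  \<open>l\<close>, as \<open>l \<ge> ln 2 \<ge> 1 / 2\<close>. The dependence on \<open>D\<close>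
  is explicit and \<open>S\<close> does not depend on \<open>D\<close>, because
  \<open>lower_rate\<close> fixes one of its constants only after \<open>S\<close>.\<close>

lemma ln_inverse_rate_bound:
  fixes p q :: real
  assumes "p \<ge> 0"
  obtains S where "S > 0" "\<And>D y l. 0 < D \<Longrightarrow> D \<le> 1 \<Longrightarrow> 1 \<le> y \<Longrightarrow> ln y \<le> l \<Longrightarrow> ln 2 \<le> l \<Longrightarrow>
      D * (y powr (- p) * l powr q) \<le> 1 \<Longrightarrow>
      ln (2 + 1 / (D * (y powr (- p) * l powr q))) \<le> (S - 2 * ln D) * l"
proof
  \<comment> \<open>The summands bound \<open>ln 3\<close>, \<open>p * ln y\<close> and
    \<open>- q * ln l\<close>, in this order.\<close>
  define S where "S = 4 + p + \<bar>q\<bar> * 3"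
  show "S > 0" using assms by (simp add: S_def add_pos_nonneg)
  fix D y l :: real
  assume D: "0 < D" "D \<le> 1" and y: "1 \<le> y" "ln y \<le> l" and l: "ln 2 \<le> l"
    and le: "D * (y powr (- p) * l powr q) \<le> 1"
  define E where "E = D * (y powr (- p) * l powr q)"
  have half: "1 / 2 \<le> ln (2::real)"
    using ln_add_one_self_le_self2[of "-1/2::real"] by (simp add: ln_div)
  then have "l \<ge> 1 / 2" "l > 0" using l by linarith+
  have "E > 0" "E \<le> 1" using D y \<open>l > 0\<close> le by (auto simp: E_def)
  have "2 + 1 / E \<le> 3 * (1 / E)"
    using \<open>E > 0\<close> \<open>E \<le> 1\<close> by (simp add: field_simps)
  then have "ln (2 + 1 / E) \<le> ln (3 * (1 / E))"
    using \<open>E > 0\<close> by (subst ln_le_cancel_iff) (auto intro: add_pos_pos)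
  also have "\<dots> = ln 3 - ln E"
    using \<open>E > 0\<close> by (simp add: ln_mult ln_div)
  also have "ln E = ln D - p * ln y + q * ln l"
    using D y \<open>l > 0\<close> by (simp add: E_def ln_mult ln_powr)
  also have "ln 3 - (ln D - p * ln y + q * ln l) \<le> 4 * l + (- 2 * ln D) * l + p * l + \<bar>q\<bar> * 3 * l"
  proof -
    have "ln 3 \<le> 4 * l" using ln_le_minus_one[of "3::real"] \<open>l \<ge> 1 / 2\<close> by simp
    moreover have "- ln D * 1 \<le> - ln D * (2 * l)"
      using D \<open>l \<ge> 1 / 2\<close> by (intro mult_left_mono) auto
    moreover have "p * ln y \<le> p * l" using assms y by (intro mult_left_mono)
    moreover have "- (q * ln l) \<le> \<bar>q\<bar> * (3 * l)"
    proof -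
      have "ln l \<le> l" using ln_le_minus_one[of l] \<open>l > 0\<close> by simp
      moreover have "- ln l \<le> 3 * l"
      proof -
        have "- ln l = ln (1 / l)" using \<open>l > 0\<close> by (simp add: ln_div)
        also have "\<dots> \<le> 1 / l - 1" using \<open>l > 0\<close> by (intro ln_le_minus_one) simp
        also have "\<dots> \<le> 2 - 1" using \<open>l \<ge> 1 / 2\<close> by (simp add: field_simps)
        also have "\<dots> \<le> 3 * l" using \<open>l \<ge> 1 / 2\<close> by simp
        finally show ?thesis .
      qed
      ultimately have "\<bar>ln l\<bar> \<le> 3 * l" using \<open>l > 0\<close> by linarith
      then have "\<bar>q\<bar> * \<bar>ln l\<bar> \<le> \<bar>q\<bar> * (3 * l)" by (intro mult_left_mono) auto
      then show ?thesis using abs_le_D2[of "q * ln l"] by (simp add: abs_mult)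
    qed
    ultimately show ?thesis by simp
  qed
  also have "\<dots> = (S - 2 * ln D) * l" by (simp add: S_def algebra_simps)
  finally show "ln (2 + 1 / (D * (y powr (- p) * l powr q))) \<le> (S - 2 * ln D) * l"
    by (simp add: E_def)
qed

text \<open>Powers dominate logarithms: for \<open>q > 0\<close>,
  \<open>ln y \<le> y powr r / r\<close> with \<open>r = p / q\<close> gives a bound on
  \<open>l powr q\<close> by a multiple of \<open>y powr p\<close>. It is used to keep \<delta> and
  \<epsilon> below 1 for every \<open>m \<ge> 1\<close>.\<close>

lemma powr_ln_bounded:
  fixes p q s :: real
  assumes "p > 0" "s \<ge> 0"
  obtains S where "S \<ge> 1" "\<And>y l. 1 \<le> y \<Longrightarrow> ln 2 \<le> l \<Longrightarrow> l \<le> 1 + s * ln y \<Longrightarrow>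
      y powr (- p) * l powr q \<le> S"
proof (cases "q \<le> 0")
  case True
  show ?thesis
  proof
    show "max 1 (ln 2 powr q) \<ge> (1::real)" by simp
    fix y l :: real assume y: "1 \<le> y" "ln 2 \<le> l"
    have "y powr (- p) \<le> y powr 0" using y assms by (intro powr_mono) auto
    moreover have "l powr q \<le> ln 2 powr q" using y True by (intro powr_mono2') auto
    ultimately have "y powr (- p) * l powr q \<le> 1 * ln 2 powr q"
      using y by (intro mult_mono) auto
    then show "y powr (- p) * l powr q \<le> max 1 (ln 2 powr q)" by simp
  qed
next
  case False
  define r where "r = p / q"
  have "r > 0" using False assms by (simp add: r_def)
  define S where "S = (1 + s / r) powr q"
  show ?thesis
  proof
    show "S \<ge> 1" unfolding S_def using False \<open>r > 0\<close> assms by (intro ge_one_powr_ge_zero) auto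
    fix y l :: real assume y: "1 \<le> y" and l: "ln 2 \<le> l" "l \<le> 1 + s * ln y"
    have "l > 0" using l(1) ln_gt_zero[of "2::real"] by linarith
    have yr: "1 \<le> y powr r" using y \<open>r > 0\<close> by (intro ge_one_powr_ge_zero) auto
    have "ln y \<le> y powr r / r" using y \<open>r > 0\<close> by (intro ln_powr_bound)
    then have "s * ln y \<le> s * (y powr r / r)" using assms by (intro mult_left_mono)
    then have "l \<le> (1 + s / r) * y powr r"
      using l(2) yr by (simp add: algebra_simps)
    then have "l powr q \<le> ((1 + s / r) * y powr r) powr q"
      using \<open>l > 0\<close> False by (intro powr_mono2) auto
    also have "\<dots> = S * y powr p"
      using assms \<open>r > 0\<close> False by (simp add: S_def powr_mult powr_powr r_def)
    finally have "y powr (- p) * l powr q \<le> y powr (- p) * (S * y powr p)"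
      by (intro mult_left_mono) auto
    also have "\<dots> = S" using y by (simp add: powr_minus)
    finally show "y powr (- p) * l powr q \<le> S" .
  qed
qed

text \<open>With \<open>y = m powr (1 / (\<beta> + 1))\<close> and \<open>l = ln (2 * m)\<close>,
  everything is compared with \<open>T = y * l powr \<tau>\<close>. The left side of the balance is
  at most \<open>K * T\<close> for \<delta> of order
  \<open>y powr (- \<beta>) * l powr (\<tau> - 1)\<close>. For \<epsilon> of order
  \<open>y powr (- \<alpha>) * l powr (- \<alpha> * (\<tau> + a))\<close> the right side is at least
  a multiple of \<open>T\<close>, and this multiple reaches \<open>K\<close> when the constant in
  \<epsilon> is small.\<close>

lemma lower_rate:
  fixes \<alpha> \<beta> a b c c' :: real
  assumes "\<alpha> > 0" "\<beta> > 0" "a \<ge> 0" "b \<ge> 0" "c > 0" "c' > 0"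
  obtains C where "C > 0" "\<And>m::nat. m \<ge> 1 \<Longrightarrow>
      \<exists>\<delta> \<epsilon>. 0 < \<delta> \<and> \<delta> < 1 \<and> 0 < \<epsilon> \<and> \<epsilon> < 1 \<and>
        ln 4 + c * (\<delta> powr (- 1 / \<beta>) * ln (2 + 1 / \<delta>) powr b) + 2 * real m * \<delta> * ln (real m + 1)
          \<le> c' * (\<epsilon> powr (- 1 / \<alpha>) / ln (2 + 1 / \<epsilon>) powr a) \<and>
        C * real m powr (- \<alpha> / (\<beta> + 1))
            * ln (2 * real m) powr (- \<alpha> * (2 + \<beta> * b) / (\<beta> + 1) - \<alpha> * a) \<le> \<epsilon> / 16"
proof -
  define \<tau> where "\<tau> = (2 + \<beta> * b) / (\<beta> + 1)"
  \<comment> \<open>Chosen such that \<open>m * \<delta> * l\<close> is a multiple of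
    \<open>T\<close>; the bound on the entropy at \<delta> then has the logarithmic exponent
    \<open>\<tau> - 1 / \<beta>\<close>, which is below \<tau>.\<close>
  define q where "q = \<tau> - 1"
  define r where "r = - \<alpha> * \<tau> - \<alpha> * a"
  have "\<tau> * (\<beta> + 1) = 2 + \<beta> * b" using assms by (simp add: \<tau>_def)
  then have q_balance: "- q / \<beta> + b = \<tau> - 1 / \<beta>" using assms by (simp add: q_def field_simps)
  have "0 \<le> \<beta> + 1" using assms by simp
  have "\<tau> > 0" using assms by (simp add: \<tau>_def add_pos_nonneg)
  obtain S1 where S1: "S1 \<ge> 1" "\<And>y l. 1 \<le> y \<Longrightarrow> ln 2 \<le> l \<Longrightarrow> l \<le> 1 + (\<beta> + 1) * ln y \<Longrightarrow>
      y powr (- \<beta>) * l powr q \<le> S1"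
    using powr_ln_bounded[OF \<open>\<beta> > 0\<close> \<open>0 \<le> \<beta> + 1\<close>, where q = q] by blast
  obtain S2 where S2: "S2 \<ge> 1" "\<And>y l. 1 \<le> y \<Longrightarrow> ln 2 \<le> l \<Longrightarrow> l \<le> 1 + (\<beta> + 1) * ln y \<Longrightarrow>
      y powr (- \<alpha>) * l powr r \<le> S2"
    using powr_ln_bounded[OF \<open>\<alpha> > 0\<close> \<open>0 \<le> \<beta> + 1\<close>, where q = r] by blast
  obtain S3 where S3: "S3 > 0" "\<And>D y l. 0 < D \<Longrightarrow> D \<le> 1 \<Longrightarrow> 1 \<le> y \<Longrightarrow> ln y \<le> l \<Longrightarrow> ln 2 \<le> l \<Longrightarrow>
      D * (y powr (- \<beta>) * l powr q) \<le> 1 \<Longrightarrow>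
      ln (2 + 1 / (D * (y powr (- \<beta>) * l powr q))) \<le> (S3 - 2 * ln D) * l"
    using ln_inverse_rate_bound[OF less_imp_le[OF \<open>\<beta> > 0\<close>], where q = q] by blast
  obtain S4 where S4: "S4 > 0" "\<And>D y l. 0 < D \<Longrightarrow> D \<le> 1 \<Longrightarrow> 1 \<le> y \<Longrightarrow> ln y \<le> l \<Longrightarrow> ln 2 \<le> l \<Longrightarrow>
      D * (y powr (- \<alpha>) * l powr r) \<le> 1 \<Longrightarrow>
      ln (2 + 1 / (D * (y powr (- \<alpha>) * l powr r))) \<le> (S4 - 2 * ln D) * l"
    using ln_inverse_rate_bound[OF less_imp_le[OF \<open>\<alpha> > 0\<close>], where q = r] by blast
  \<comment> \<open>The constant in \<delta>, small enough that
    \<open>\<delta> \<le> D * S1 < 1\<close>.\<close>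
  define D where "D = 1 / (2 * S1)"
  have D: "0 < D" "D \<le> 1" "D * S1 < 1" using S1(1) by (auto simp: D_def)
  define S5 where "S5 = S3 - 2 * ln D"
  have "ln D \<le> 0" using D by simp
  then have "S5 > 0" using S3(1) by (simp add: S5_def)
  \<comment> \<open>One summand for each of \<open>ln 4\<close>, the entropy at \<delta> and the
    positions of the errors, all in units of \<open>T\<close>.\<close>
  define K where "K = ln 4 * ln 2 powr (- \<tau>) + c * D powr (- 1 / \<beta>) * S5 powr b * ln 2 powr (- 1 / \<beta>) + 2 * D"
  have "K > 0" using D \<open>c > 0\<close> by (auto simp: K_def intro!: add_nonneg_pos)
  \<comment> \<open>The constant in \<epsilon> will be \<open>exp (- z)\<close>. The first property
    yields the balance, the second yields \<open>\<epsilon> < 1\<close>.\<close>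
  obtain z where z: "K * (S4 + 2 * z) powr a \<le> c' * exp (z / \<alpha>)" "z > ln (2 * S2)"
    using powr_affine_le_exp[OF \<open>K > 0\<close> \<open>c' > 0\<close> \<open>\<alpha> > 0\<close> \<open>a \<ge> 0\<close> \<open>S4 > 0\<close>] by blast
  define D' where "D' = exp (- z)"
  have "z > 0" using z(2) S2(1) ln_gt_zero[of "2 * S2"] by linarith
  have "exp (- z) < exp (- ln (2 * S2))" using z(2) by simp
  then have D': "0 < D'" "D' \<le> 1" "D' * S2 < 1"
    using \<open>z > 0\<close> S2(1) by (auto simp: D'_def exp_minus field_simps)
  have "D' / 16 > 0" using D' by simp
  moreover have "\<exists>\<delta> \<epsilon>. 0 < \<delta> \<and> \<delta> < 1 \<and> 0 < \<epsilon> \<and> \<epsilon> < 1 \<and>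
        ln 4 + c * (\<delta> powr (- 1 / \<beta>) * ln (2 + 1 / \<delta>) powr b) + 2 * real m * \<delta> * ln (real m + 1)
          \<le> c' * (\<epsilon> powr (- 1 / \<alpha>) / ln (2 + 1 / \<epsilon>) powr a) \<and>
        D' / 16 * real m powr (- \<alpha> / (\<beta> + 1)) * ln (2 * real m) powr r \<le> \<epsilon> / 16"
    if "m \<ge> 1" for m :: nat
  proof (intro exI conjI)
    define y where "y = real m powr (1 / (\<beta> + 1))"
    define l where "l = ln (2 * real m)"
    define \<delta> where "\<delta> = D * (y powr (- \<beta>) * l powr q)"
    define \<epsilon> where "\<epsilon> = D' * (y powr (- \<alpha>) * l powr r)"
    define T where "T = y * l powr \<tau>"
    have "y \<ge> 1" using that assms by (simp add: y_def ge_one_powr_ge_zero)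
    have m: "real m = y * y powr \<beta>"
      using that assms by (simp add: y_def powr_powr flip: powr_add) (simp add: field_simps)
    have l2: "ln 2 \<le> l" using that by (simp add: l_def)
    then have "l > 0" using ln_gt_zero[of "2::real"] by linarith
    have lny: "ln y = ln (real m) / (\<beta> + 1)"
      using that by (simp add: y_def ln_powr)
    have "ln 2 \<le> (1::real)" using ln_le_minus_one[of "2::real"] by simp
    then have l_le: "l \<le> 1 + (\<beta> + 1) * ln y"
      using that assms by (simp add: lny l_def ln_mult)
    have lny_le: "ln y \<le> l"
    proof -
      have "ln (real m) / (\<beta> + 1) \<le> ln (real m) / 1"
        using that assms by (intro divide_left_mono) auto
      also have "\<dots> \<le> l" using that by (simp add: l_def)
      finally show ?thesis by (simp add: lny)
    qed
    show "\<delta> > 0" "\<epsilon> > 0" using D D' \<open>y \<ge> 1\<close> \<open>l > 0\<close> by (auto simp: \<delta>_def \<epsilon>_def)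
    have "\<delta> \<le> D * S1"
      unfolding \<delta>_def using S1(2)[OF \<open>y \<ge> 1\<close> l2 l_le] D by (intro mult_left_mono) auto
    then show "\<delta> < 1" using D by simp
    have "\<epsilon> \<le> D' * S2"
      unfolding \<epsilon>_def using S2(2)[OF \<open>y \<ge> 1\<close> l2 l_le] D' by (intro mult_left_mono) auto
    then show "\<epsilon> < 1" using D' by simp
    have mp: "real m powr (- \<alpha> / (\<beta> + 1)) = y powr (- \<alpha>)"
      by (simp add: y_def powr_powr)
    show "D' / 16 * real m powr (- \<alpha> / (\<beta> + 1)) * ln (2 * real m) powr r \<le> \<epsilon> / 16"
      unfolding mp by (simp add: \<epsilon>_def flip: l_def)
    have "ln (2 + 1 / \<delta>) \<le> S5 * l"
      unfolding \<delta>_def S5_def using D \<open>y \<ge> 1\<close> l2 lny_le \<open>\<delta> < 1\<close> by (intro S3(2)) (auto simp: \<delta>_def)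
    then have "ln (2 + 1 / \<delta>) powr b \<le> (S5 * l) powr b"
      using \<open>\<delta> > 0\<close> \<open>b \<ge> 0\<close> by (intro powr_mono2) auto
    then have "c * (\<delta> powr (- 1 / \<beta>) * ln (2 + 1 / \<delta>) powr b)
        \<le> c * (\<delta> powr (- 1 / \<beta>) * (S5 * l) powr b)"
      using \<open>c > 0\<close> by (intro mult_left_mono) auto
    also have "\<dots> = c * D powr (- 1 / \<beta>) * S5 powr b * (y * (l powr (- q / \<beta>) * l powr b))"
      using D \<open>y \<ge> 1\<close> \<open>\<beta> > 0\<close> \<open>l > 0\<close> \<open>S5 > 0\<close>
      by (simp add: \<delta>_def powr_mult powr_powr mult_ac)
    also have "l powr (- q / \<beta>) * l powr b = l powr (\<tau> - 1 / \<beta>)"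
      unfolding powr_add[symmetric] using q_balance by simp
    also have "c * D powr (- 1 / \<beta>) * S5 powr b * (y * l powr (\<tau> - 1 / \<beta>))
        \<le> c * D powr (- 1 / \<beta>) * S5 powr b * (y * (ln 2 powr (\<tau> - 1 / \<beta> - \<tau>) * l powr \<tau>))"
      using \<open>c > 0\<close> \<open>y \<ge> 1\<close> \<open>\<beta> > 0\<close> by (intro mult_left_mono powr_mono_from_ln2 l2) auto
    also have "\<dots> = c * D powr (- 1 / \<beta>) * S5 powr b * ln 2 powr (- 1 / \<beta>) * T"
      by (simp add: T_def mult_ac)
    finally have entropy: "c * (\<delta> powr (- 1 / \<beta>) * ln (2 + 1 / \<delta>) powr b)
        \<le> c * D powr (- 1 / \<beta>) * S5 powr b * ln 2 powr (- 1 / \<beta>) * T" .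
    have "2 * real m * \<delta> * ln (real m + 1) \<le> 2 * real m * \<delta> * l"
      using that \<open>\<delta> > 0\<close> by (intro mult_left_mono) (auto simp: l_def)
    also have "\<dots> = 2 * D * (y * (l powr q * l powr 1))"
      using \<open>y \<ge> 1\<close> \<open>l > 0\<close> by (simp add: m \<delta>_def powr_minus field_simps)
    also have "\<dots> = 2 * D * T"
      unfolding powr_add[symmetric] by (simp add: T_def q_def)
    finally have errors: "2 * real m * \<delta> * ln (real m + 1) \<le> 2 * D * T" .
    have "ln 4 \<le> ln 4 * ln 2 powr (- \<tau>) * T"
    proof -
      have "1 \<le> ln 2 powr (- \<tau>) * (l powr \<tau>)"
        using powr_mono_from_ln2[OF l2, of 0 \<tau>] \<open>\<tau> > 0\<close> \<open>l > 0\<close> by simp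
      also have "\<dots> * 1 \<le> ln 2 powr (- \<tau>) * l powr \<tau> * y"
        using \<open>y \<ge> 1\<close> by (intro mult_left_mono) auto
      finally have "ln 4 * 1 \<le> ln 4 * (ln 2 powr (- \<tau>) * l powr \<tau> * y)"
        by (intro mult_left_mono) auto
      then show ?thesis by (simp add: T_def mult_ac)
    qed
    moreover have "K * T = ln 4 * ln 2 powr (- \<tau>) * T
        + c * D powr (- 1 / \<beta>) * S5 powr b * ln 2 powr (- 1 / \<beta>) * T + 2 * D * T"
      by (simp only: K_def distrib_right)
    ultimately have "ln 4 + c * (\<delta> powr (- 1 / \<beta>) * ln (2 + 1 / \<delta>) powr b)
        + 2 * real m * \<delta> * ln (real m + 1) \<le> K * T"
      using entropy errors by linarith
    \<comment> \<open>The power of \<epsilon> equals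
      \<open>exp (z / \<alpha>) * T * l powr a\<close>. Its last factor compensates the logarithm,
      which is at most \<open>(S4 + 2 * z) * l\<close>; the choice of \<open>z\<close> settles the
      constants.\<close>
    also have "K * T \<le> c' * (\<epsilon> powr (- 1 / \<alpha>) / ln (2 + 1 / \<epsilon>) powr a)"
    proof -
      have "ln (2 + 1 / \<epsilon>) \<le> (S4 - 2 * ln D') * l"
        unfolding \<epsilon>_def using D' \<open>y \<ge> 1\<close> l2 lny_le \<open>\<epsilon> < 1\<close> by (intro S4(2)) (auto simp: \<epsilon>_def)
      then have "ln (2 + 1 / \<epsilon>) powr a \<le> ((S4 + 2 * z) * l) powr a"
        using \<open>\<epsilon> > 0\<close> \<open>a \<ge> 0\<close> by (intro powr_mono2) (auto simp: D'_def)
      then have "K * T * ln (2 + 1 / \<epsilon>) powr a \<le> K * T * ((S4 + 2 * z) * l) powr a"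
        using \<open>K > 0\<close> \<open>y \<ge> 1\<close> by (intro mult_left_mono) (auto simp: T_def)
      also have "\<dots> = K * (S4 + 2 * z) powr a * (T * l powr a)"
        using \<open>l > 0\<close> \<open>S4 > 0\<close> \<open>z > 0\<close> by (simp add: powr_mult mult_ac)
      also have "\<dots> \<le> c' * exp (z / \<alpha>) * (T * l powr a)"
        using z(1) \<open>y \<ge> 1\<close> by (intro mult_right_mono) (auto simp: T_def)
      also have "\<dots> = c' * \<epsilon> powr (- 1 / \<alpha>)"
      proof -
        have "\<epsilon> powr (- 1 / \<alpha>) = D' powr (- 1 / \<alpha>) * (y * l powr (- r / \<alpha>))"
          using D' \<open>y \<ge> 1\<close> \<open>\<alpha> > 0\<close> by (simp add: \<epsilon>_def powr_mult powr_powr)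
        also have "D' powr (- 1 / \<alpha>) = exp (z / \<alpha>)"
          by (simp add: D'_def powr_def)
        also have "- r / \<alpha> = \<tau> + a"
          using \<open>\<alpha> > 0\<close> by (simp add: r_def field_simps)
        finally show ?thesis by (simp add: T_def powr_add mult_ac)
      qed
      finally have "K * T * ln (2 + 1 / \<epsilon>) powr a \<le> c' * \<epsilon> powr (- 1 / \<alpha>)" .
      moreover have "ln (2 + 1 / \<epsilon>) > 0"
        using \<open>\<epsilon> > 0\<close> by (intro ln_gt_zero) (simp add: add_strict_increasing)
      ultimately show ?thesis by (simp add: field_simps)
    qed
    finally show "ln 4 + c * (\<delta> powr (- 1 / \<beta>) * ln (2 + 1 / \<delta>) powr b)
        + 2 * real m * \<delta> * ln (real m + 1) \<le> c' * (\<epsilon> powr (- 1 / \<alpha>) / ln (2 + 1 / \<epsilon>) powr a)" .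
  qed
  moreover have "- \<alpha> * (2 + \<beta> * b) / (\<beta> + 1) - \<alpha> * a = r"
    by (simp add: r_def \<tau>_def)
  ultimately show ?thesis by (intro that[of "D' / 16"]) (simp_all only:)
qed

section \<open>Minimax risk of horizon classes\<close>

lemma le_exp_of_ln_le:
  assumes "ln (real n) \<le> v"
  shows "real n \<le> exp v"
proof (cases "n = 0")
  case False
  then have "real n = exp (ln (real n))" by simp
  also have "\<dots> \<le> exp v" using assms by (simp only: exp_le_cancel_iff)
  finally show ?thesis .
qed simp

lemma horizon_L2:
  assumes "b \<in> cont_cube_unit (d - 1)"
  shows "horizon d b \<in> L2_functions (cube_measure d)"
  by (intro zero_one_valued_L2_functions prob_space_cube_measure borel_measurable_cube_measureI
      horizon_measurable assms horizon_range)

text \<open>Estimators are measurable in the labelled sample, whereas the risk integrates over the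
  sample points; this map connects the two.\<close>

lemma sample_measurable:
  assumes "h \<in> borel_measurable (restrict_space borel (cube d))" "\<And>x. h x \<in> {0, 1}"
  shows "sample m h \<in> (\<Pi>\<^sub>M i\<in>{..<m}. cube_measure d) \<rightarrow>\<^sub>M (\<Pi>\<^sub>M i\<in>{..<m}. labelled_space d)"
proof -
  have h: "h \<in> restrict_space borel (cube d) \<rightarrow>\<^sub>M count_space {0, 1}"
  proof (subst measurable_count_space_eq2)
    show "h \<in> space (restrict_space borel (cube d)) \<rightarrow> {0, 1} \<and>
      (\<forall>a\<in>{0, 1}. h -` {a} \<inter> space (restrict_space borel (cube d)) \<in> sets (restrict_space borel (cube d)))"
      by (intro conjI funcsetI assms(2) ballI measurable_sets[OF assms(1)]) simp
  qed simp
  have "(\<lambda>x. (x, h x)) \<in> cube_measure d \<rightarrow>\<^sub>M labelled_space d"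
    unfolding labelled_space_def
    by (intro measurable_Pair ident_measurable_cube_measure
        measurable_compose[OF ident_measurable_cube_measure h])
  then show ?thesis
    unfolding sample_def
    by (intro measurable_restrict measurable_compose[OF measurable_component_singleton])
qed

lemma empirical_errors_pred:
  assumes "g \<in> borel_measurable (restrict_space borel (cube d))"
    and "g' \<in> borel_measurable (restrict_space borel (cube d))"
  shows "Measurable.pred (\<Pi>\<^sub>M i\<in>{..<m}. labelled_space d)
    (\<lambda>s. (\<Sum>i<m. (g (fst (s i)) - snd (s i))\<^sup>2) \<le> (\<Sum>i<m. (g' (fst (s i)) - snd (s i))\<^sup>2))"
proof -
  have *: "(\<lambda>s. \<Sum>i<m. (f (fst (s i)) - snd (s i))\<^sup>2) \<in> borel_measurable (\<Pi>\<^sub>M i\<in>{..<m}. labelled_space d)"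
    if f: "f \<in> borel_measurable (restrict_space borel (cube d))" for f
  proof (intro borel_measurable_sum borel_measurable_power borel_measurable_diff)
    fix i assume "i \<in> {..<m}"
    then have c: "(\<lambda>s. s i) \<in> (\<Pi>\<^sub>M i\<in>{..<m}. labelled_space d) \<rightarrow>\<^sub>M labelled_space d"
      by (rule measurable_component_singleton)
    have "(\<lambda>z. f (fst z)) \<in> borel_measurable (labelled_space d)"
      unfolding labelled_space_def by (rule measurable_compose[OF measurable_fst f])
    then show "(\<lambda>s. f (fst (s i))) \<in> borel_measurable (\<Pi>\<^sub>M i\<in>{..<m}. labelled_space d)"
      by (rule measurable_compose[OF c])
    have "(snd :: (nat \<Rightarrow> real) \<times> real \<Rightarrow> real) \<in> borel_measurable (labelled_space d)"
      unfolding labelled_space_def by (rule measurable_compose[OF measurable_snd]) simp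
    then show "(\<lambda>s. snd (s i)) \<in> borel_measurable (\<Pi>\<^sub>M i\<in>{..<m}. labelled_space d)"
      by (rule measurable_compose[OF c])
  qed
  show ?thesis
    using borel_measurable_le[OF *[OF assms(1)] *[OF assms(2)]] by (simp add: pred_def)
qed

text \<open>The zero estimator has loss at most 1. This covers the sample sizes for which the
  claimed rate is at least 1.\<close>

lemma minimax_risk_le_one:
  assumes "\<C> \<subseteq> cont_cube_unit (d - 1)"
  shows "minimax_risk d m (horizons d \<C>) \<le> 1"
proof -
  interpret prob_space "cube_measure d" by (rule prob_space_cube_measure)
  interpret Q: prob_space "\<Pi>\<^sub>M i\<in>{..<m}. cube_measure d"
    by (intro prob_space_PiM prob_space_cube_measure)
  define A where "A = (\<lambda>(s :: nat \<Rightarrow> (nat \<Rightarrow> real) \<times> real) (x :: nat \<Rightarrow> real). 0 :: real)"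
  have "A \<in> estimators d m"
    by (auto simp: A_def estimators_def space_L2_space L2_functions_def)
  moreover have "risk d m A h \<le> 1" if h: "h \<in> horizons d \<C>" for h
  proof -
    obtain b where b: "h = horizon d b" "b \<in> cont_cube_unit (d - 1)"
      using h assms by (auto simp: horizons_def)
    have "(\<integral>x. (h x)\<^sup>2 \<partial>cube_measure d) \<le> (\<integral>x. 1 \<partial>cube_measure d)"
    proof (intro integral_mono)
      show "integrable (cube_measure d) (\<lambda>x. (h x)\<^sup>2)"
        using horizon_L2[OF b(2)] by (simp add: L2_functions_def b)
      show "(h x)\<^sup>2 \<le> 1" for x
        by (simp add: b horizon_def)
    qed simp
    then have "(L2_nrm (cube_measure d) (\<lambda>x. A s x - h x))\<^sup>2 \<le> 1" for s
      by (simp add: L2_nrm_sq A_def prob_space)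
    then have "risk d m A h \<le> (\<integral>\<^sup>+X. 1 \<partial>(\<Pi>\<^sub>M i\<in>{..<m}. cube_measure d))"
      unfolding risk_def by (intro nn_integral_mono) (simp add: ennreal_le_1)
    then show ?thesis by (simp add: Q.emeasure_space_1)
  qed
  ultimately show ?thesis
    unfolding minimax_risk_def by (intro INF_lower2[of A] SUP_least) auto
qed

text \<open>A maximal \<epsilon>-packing set of boundaries is an \<epsilon>-net with at most
  \<open>exp v\<close> elements. The estimator minimises the empirical error over the corresponding
  horizon functions.\<close>

lemma minimax_risk_upper:
  assumes "d \<ge> 1" and \<C>: "\<C> \<subseteq> cont_cube_unit (d - 1)" "\<C> \<noteq> {}" and "\<epsilon> > 0"
    and entropy: "packing_entropy (L1_dist (cube_measure (d - 1))) \<C> \<epsilon> \<le> ereal v"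
  shows "minimax_risk d m (horizons d \<C>) \<le> ennreal (4 * \<epsilon> + exp (v - real m * \<epsilon>))"
proof -
  let ?M = "cube_measure d" and ?dist = "L1_dist (cube_measure (d - 1))"
  obtain B where B: "finite B" "packing_set ?dist \<C> \<epsilon> B"
    "packing_entropy ?dist \<C> \<epsilon> = ereal (ln (real (card B)))"
    "\<And>N'. finite N' \<Longrightarrow> packing_set ?dist \<C> \<epsilon> N' \<Longrightarrow> card N' \<le> card B"
    using packing_entropy_attained[OF entropy] by blast
  have net: "\<exists>b'\<in>B. ?dist b b' \<le> \<epsilon>" if "b \<in> \<C>" for b
    using that \<open>\<epsilon> > 0\<close>
    by (intro maximal_packing_set_covers[OF B(1,2,4) L1_dist_commute]) (auto simp: L1_dist_self)
  have "B \<subseteq> \<C>" "B \<noteq> {}" using B(2) net \<open>\<C> \<noteq> {}\<close> by (auto simp: packing_set_def)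
  have cardB: "real (card B) \<le> exp v"
    using entropy B(3) by (intro le_exp_of_ln_le) simp
  define N where "N = horizon d ` B"
  have N: "finite N" "N \<noteq> {}" "card N \<le> card B"
    using B(1) \<open>B \<noteq> {}\<close> by (auto simp: N_def card_image_le)
  have Nm: "g \<in> borel_measurable (restrict_space borel (cube d))" if "g \<in> N" for g
    using that \<open>B \<subseteq> \<C>\<close> \<C> by (auto simp: N_def intro!: horizon_measurable)
  have N2: "N \<subseteq> L2_functions ?M"
    using \<open>B \<subseteq> \<C>\<close> \<C> by (auto simp: N_def intro!: horizon_L2)
  define err where "err g s = (\<Sum>i<m. (g (fst (s i)) - snd (s i))\<^sup>2)"
    for g and s :: "nat \<Rightarrow> (nat \<Rightarrow> real) \<times> real"
  obtain A where A: "A \<in> estimators d m" "\<And>s. A s \<in> N" "\<And>s g. g \<in> N \<Longrightarrow> err (A s) s \<le> err g s"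
  proof (rule finite_valued_estimator[where N = N and d = d and m = m and err = err])
    show "Measurable.pred (\<Pi>\<^sub>M i\<in>{..<m}. labelled_space d) (\<lambda>s. err g s \<le> err g' s)"
      if "g \<in> N" "g' \<in> N" for g g'
      unfolding err_def by (intro empirical_errors_pred Nm that)
  qed (use N N2 in auto)
  have "risk d m A h \<le> ennreal (4 * \<epsilon> + exp (v - real m * \<epsilon>))" if h: "h \<in> horizons d \<C>" for h
  proof -
    obtain b where b: "h = horizon d b" "b \<in> \<C>"
      using h by (auto simp: horizons_def)
    obtain b' where b': "b' \<in> B" "?dist b b' \<le> \<epsilon>" using net[OF b(2)] by blast
    define g0 where "g0 = horizon d b'"
    have "g0 \<in> N" using b' by (auto simp: g0_def N_def)
    have "(L2_nrm ?M (\<lambda>x. g0 x - h x))\<^sup>2 = ?dist b' b"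
      unfolding L2_nrm_sq g0_def b(1) using b b' \<open>B \<subseteq> \<C>\<close> \<C> \<open>d \<ge> 1\<close>
      by (intro horizon_sq_dist) auto
    then have close: "(L2_nrm ?M (\<lambda>x. g0 x - h x))\<^sup>2 \<le> \<epsilon>"
      using b' by (simp add: L1_dist_commute)
    have err_sample: "err g (sample m h X) = (\<Sum>i<m. (g (X i) - h (X i))\<^sup>2)" for g X
      by (simp add: err_def sample_def)
    have "risk d m A h \<le> ennreal (4 * \<epsilon> + real (card N) * exp (- (real m * \<epsilon>)))"
      unfolding risk_def
    proof (rule empirical_risk_minimiser_bound[OF prob_space_cube_measure N(1) _ _ \<open>g0 \<in> N\<close> close])
      show "g \<in> borel_measurable ?M" if "g \<in> insert h N" for g
        using that Nm b \<C> by (auto intro!: borel_measurable_cube_measureI horizon_measurable)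
      show "g x \<in> {0, 1}" if "g \<in> insert h N" for g x
        using that b by (auto simp: N_def horizon_def)
      show "A (sample m h X) \<in> N \<and> (\<Sum>i<m. (A (sample m h X) (X i) - h (X i))\<^sup>2)
          \<le> (\<Sum>i<m. (g0 (X i) - h (X i))\<^sup>2)" for X
        using A(2) A(3)[OF \<open>g0 \<in> N\<close>, of "sample m h X"] by (simp add: err_sample)
    qed
    also have "\<dots> \<le> ennreal (4 * \<epsilon> + exp v * exp (- (real m * \<epsilon>)))"
      using N(3) cardB by (intro ennreal_leI add_left_mono mult_right_mono) auto
    finally show ?thesis by (simp add: exp_diff exp_minus field_simps)
  qed
  then show ?thesis
    unfolding minimax_risk_def using A(1) by (intro INF_lower2[of A] SUP_least) auto
qed

text \<open>\<open>P\<close> comes from a maximal \<epsilon>-packing set and \<open>N\<close> from a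
  \<delta>-net of boundaries; \<open>balance\<close> is the logarithm of the cardinality condition
  in \<open>sup_risk_lower_bound\<close>. The bound \<open>w\<close> guarantees that a finite
  maximal \<epsilon>-packing set exists.\<close>

lemma minimax_risk_lower:
  assumes "d \<ge> 1" and \<C>: "\<C> \<subseteq> cont_cube_unit (d - 1)" and "\<delta> > 0" "\<epsilon> > 0" "m \<ge> 1"
    and entropy_\<delta>: "packing_entropy (L1_dist (cube_measure (d - 1))) \<C> \<delta> \<le> ereal v"
    and entropy_\<epsilon>: "packing_entropy (L1_dist (cube_measure (d - 1))) \<C> \<epsilon> \<le> ereal w"
      "ereal u \<le> packing_entropy (L1_dist (cube_measure (d - 1))) \<C> \<epsilon>"
    and balance: "ln 4 + v + 2 * real m * \<delta> * ln (real m + 1) \<le> u"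
  shows "ennreal (\<epsilon> / 16) \<le> minimax_risk d m (horizons d \<C>)"
proof -
  let ?M = "cube_measure d" and ?dist = "L1_dist (cube_measure (d - 1))"
  obtain B where B: "finite B" "packing_set ?dist \<C> \<delta> B"
    "packing_entropy ?dist \<C> \<delta> = ereal (ln (real (card B)))"
    "\<And>N'. finite N' \<Longrightarrow> packing_set ?dist \<C> \<delta> N' \<Longrightarrow> card N' \<le> card B"
    using packing_entropy_attained[OF entropy_\<delta>] by blast
  have "\<exists>b'\<in>B. ?dist b b' \<le> \<delta>" if "b \<in> \<C>" for b
    using that \<open>\<delta> > 0\<close>
    by (intro maximal_packing_set_covers[OF B(1,2,4) L1_dist_commute]) (auto simp: L1_dist_self)
  then obtain \<mu> where \<mu>: "\<And>b. b \<in> \<C> \<Longrightarrow> \<mu> b \<in> B \<and> ?dist b (\<mu> b) \<le> \<delta>" by metis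
  obtain F where F: "finite F" "packing_set ?dist \<C> \<epsilon> F"
    "packing_entropy ?dist \<C> \<epsilon> = ereal (ln (real (card F)))"
    "\<And>N'. finite N' \<Longrightarrow> packing_set ?dist \<C> \<epsilon> N' \<Longrightarrow> card N' \<le> card F"
    using packing_entropy_attained[OF entropy_\<epsilon>(1)] by blast
  have sub: "B \<subseteq> \<C>" "F \<subseteq> \<C>"
    by (rule packing_set_subset, fact)+
  have sq: "(L2_nrm ?M (\<lambda>x. horizon d b x - horizon d b' x))\<^sup>2 = ?dist b b'"
    if "b \<in> \<C>" "b' \<in> \<C>" for b b'
    unfolding L2_nrm_sq using that \<C> \<open>d \<ge> 1\<close> by (intro horizon_sq_dist) auto
  have inj: "inj_on (horizon d) F"
  proof (rule inj_onI, rule ccontr)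
    fix b b' assume b: "b \<in> F" "b' \<in> F" "horizon d b = horizon d b'" "b \<noteq> b'"
    then have "?dist b b' = (L2_nrm ?M (\<lambda>x. horizon d b x - horizon d b' x))\<^sup>2"
      using sub by (intro sq[symmetric]) auto
    then have "?dist b b' = 0" by (simp add: b(3) L2_nrm_sq)
    moreover have "\<epsilon> < ?dist b b'" using b F(2) unfolding packing_set_def by blast
    ultimately show False using \<open>\<epsilon> > 0\<close> by linarith
  qed
  define P where "P = horizon d ` F"
  define N where "N = horizon d ` B"
  \<comment> \<open>Different boundaries of the packing set have different horizon functions, so the
    boundary can be recovered from \<open>h\<close> and replaced by a nearby element of the
    net.\<close>
  define \<nu> where "\<nu> h = horizon d (\<mu> (inv_into F (horizon d) h))" for h
  have \<nu>: "\<nu> (horizon d b) = horizon d (\<mu> b)" if "b \<in> F" for b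
    using that inj by (simp add: \<nu>_def)
  have "card P = card F" using inj by (simp add: P_def card_image)
  have "card N \<le> card B" using B(1) by (simp add: N_def card_image_le)
  have cardB: "real (card B) \<le> exp v"
    using entropy_\<delta> B(3) by (intro le_exp_of_ln_le) simp
  have uF: "u \<le> ln (real (card F))"
    using entropy_\<epsilon>(2) F(3) by simp
  \<comment> \<open>This includes an empty \<open>B\<close>, since \<open>ln 0 = 0\<close>. For the
    same reason \<open>u > 0\<close> below excludes an empty \<open>F\<close>.\<close>
  have "0 \<le> ln (real (card B))"
    by (cases "card B = 0") auto
  then have "0 \<le> v"
    using entropy_\<delta> B(3) by simp
  moreover have "0 \<le> 2 * real m * \<delta> * ln (real m + 1)"
    using \<open>\<delta> > 0\<close> by (intro mult_nonneg_nonneg) auto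
  moreover have "0 < ln (4::real)" by simp
  ultimately have "u > 0" using balance by linarith
  then have "card F > 0" using uF by (cases "card F = 0") auto
  then have "F \<noteq> {}" by auto
  define k where "k = nat \<lfloor>2 * m * \<delta>\<rfloor>"
  have card_bound: "4 * (card N * (m + 1) ^ k) \<le> card P"
  proof -
    have "real k \<le> 2 * real m * \<delta>"
      unfolding k_def using \<open>\<delta> > 0\<close> by simp
    then have "real k * ln (real m + 1) \<le> 2 * real m * \<delta> * ln (real m + 1)"
      by (intro mult_right_mono) auto
    then have "ln 4 + v + real k * ln (real m + 1) \<le> ln (real (card F))"
      using balance uF by linarith
    then have "exp (ln 4 + v + real k * ln (real m + 1)) \<le> real (card F)"
      using \<open>card F > 0\<close> by (simp add: ln_ge_iff)
    moreover have "exp (ln 4 + v + real k * ln (real m + 1)) = 4 * (exp v * (real m + 1) ^ k)"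
      by (simp add: exp_add exp_of_nat_mult)
    moreover have "4 * (real (card N) * (real m + 1) ^ k) \<le> 4 * (exp v * (real m + 1) ^ k)"
      using \<open>card N \<le> card B\<close> cardB by (intro mult_left_mono mult_right_mono) auto
    ultimately have "4 * (real (card N) * (real m + 1) ^ k) \<le> real (card P)"
      using \<open>card P = card F\<close> by linarith
    then have "real (4 * (card N * (m + 1) ^ k)) \<le> real (card P)" by (simp add: add.commute)
    then show ?thesis by (simp only: of_nat_le_iff)
  qed
  show ?thesis
    unfolding minimax_risk_def
  proof (rule INF_greatest)
    fix A assume A: "A \<in> estimators d m"
    have cont: "b \<in> cont_cube_unit (d - 1)" if "b \<in> B \<union> F" for b
      using that sub \<C> by auto
    have A_sample: "(\<lambda>X. A (sample m h X)) \<in> (\<Pi>\<^sub>M i\<in>{..<m}. ?M) \<rightarrow>\<^sub>M L2_space ?M" if "h \<in> P" for h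
    proof -
      have "h \<in> borel_measurable (restrict_space borel (cube d))"
        using that cont by (auto simp: P_def intro!: horizon_measurable)
      moreover have "h x \<in> {0, 1}" for x
        using that by (auto simp: P_def horizon_def)
      ultimately show ?thesis
        by (rule measurable_compose[OF sample_measurable A[unfolded estimators_def]])
    qed
    have "ennreal (\<epsilon> / 16) \<le> (SUP h\<in>P. \<integral>\<^sup>+X. ennreal ((L2_nrm ?M (\<lambda>x. A (sample m h X) x - h x))\<^sup>2)
        \<partial>(\<Pi>\<^sub>M i\<in>{..<m}. ?M))"
    proof (rule sup_risk_lower_bound[where N = N and \<nu> = \<nu> and \<delta> = \<delta>])
      show "prob_space ?M" by (rule prob_space_cube_measure)
      show "finite P" "P \<noteq> {}" "finite N" using F(1) B(1) \<open>F \<noteq> {}\<close> by (auto simp: P_def N_def)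
      show "\<nu> ` P \<subseteq> N" using \<nu> \<mu> sub by (auto simp: P_def N_def)
      show "g \<in> borel_measurable ?M" if "g \<in> P \<union> N" for g
        using that cont by (auto simp: P_def N_def intro!: borel_measurable_cube_measureI horizon_measurable)
      show "g x \<in> {0, 1}" if "g \<in> P \<union> N" for g x
        using that by (auto simp: P_def N_def horizon_def)
      show "(L2_nrm ?M (\<lambda>x. h x - \<nu> h x))\<^sup>2 \<le> \<delta>" if h: "h \<in> P" for h
      proof -
        obtain b where "h = horizon d b" "b \<in> F" using h by (auto simp: P_def)
        moreover from this have "b \<in> \<C>" "\<mu> b \<in> \<C>" using sub \<mu> by blast+
        ultimately show ?thesis using \<mu>[of b] by (simp add: sq \<nu>)
      qed
      show "\<epsilon> < (L2_nrm ?M (\<lambda>x. h x - h' x))\<^sup>2" if h: "h \<in> P" "h' \<in> P" "h \<noteq> h'" for h h'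
      proof -
        obtain b b' where b: "h = horizon d b" "b \<in> F" "h' = horizon d b'" "b' \<in> F"
          using h by (auto simp: P_def)
        then have "b \<noteq> b'" using h by auto
        then have "\<epsilon> < ?dist b b'" using b F(2) unfolding packing_set_def by blast
        moreover have "b \<in> \<C>" "b' \<in> \<C>" using b sub by blast+
        ultimately show ?thesis using b by (simp add: sq)
      qed
      show "A (sample m h X) \<in> L2_functions ?M"
        if "h \<in> P" "X \<in> space (\<Pi>\<^sub>M i\<in>{..<m}. ?M)" for h X
        using measurable_space[OF A_sample[OF that(1)] that(2)] by (simp add: space_L2_space)
      show "(\<lambda>X. (L2_nrm ?M (\<lambda>x. A (sample m h X) x - h x))\<^sup>2)
          \<in> borel_measurable (\<Pi>\<^sub>M i\<in>{..<m}. ?M)" if "h \<in> P" for h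
      proof -
        have "h \<in> L2_functions ?M" using that cont by (auto simp: P_def intro!: horizon_L2)
        from measurable_compose[OF A_sample[OF that] L2_nrm_sq_measurable[OF this]]
        show ?thesis .
      qed
      show "4 * (card N * (m + 1) ^ nat \<lfloor>2 * m * \<delta>\<rfloor>) \<le> card P"
        using card_bound by (simp add: k_def)
    qed (use \<open>\<delta> > 0\<close> \<open>\<epsilon> > 0\<close> \<open>m \<ge> 1\<close> in auto)
    also have "\<dots> \<le> (SUP h\<in>horizons d \<C>. risk d m A h)"
      unfolding risk_def using sub by (intro SUP_subset_mono) (auto simp: P_def horizons_def)
    finally show "ennreal (\<epsilon> / 16) \<le> (SUP h\<in>horizons d \<C>. risk d m A h)" .
  qed
qed

theorem corollary3p15:
  fixes d :: nat and \<C> :: "((nat \<Rightarrow> real) \<Rightarrow> real) set" and \<alpha> \<beta> a b :: real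
  assumes "d \<ge> 2"
    and "\<C> \<subseteq> cont_cube_unit (d - 1)"
    and "\<alpha> \<ge> \<beta>" and "\<beta> > 0" and "a \<ge> 0" and "b \<ge> 0"
    and "\<exists>c>0. \<forall>\<epsilon>. 0 < \<epsilon> \<and> \<epsilon> < 1 \<longrightarrow>
           packing_entropy (L1_dist (cube_measure (d - 1))) \<C> \<epsilon>
             \<le> ereal (c * (\<epsilon> powr (- 1 / \<beta>) * ln (2 + 1 / \<epsilon>) powr b))"
    and "\<exists>c>0. \<forall>\<epsilon>. 0 < \<epsilon> \<and> \<epsilon> < 1 \<longrightarrow>
           ereal (c * (\<epsilon> powr (- 1 / \<alpha>) / ln (2 + 1 / \<epsilon>) powr a))
             \<le> packing_entropy (L1_dist (cube_measure (d - 1))) \<C> \<epsilon>"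
  shows "\<exists>C\<^sub>1>0. \<exists>C\<^sub>2>0. \<forall>m::nat. m \<ge> 1 \<longrightarrow>
           ennreal (C\<^sub>1 * real m powr (- \<alpha> / (\<beta> + 1))
                     * ln (2 * real m) powr (- \<alpha> * (2 + \<beta> * b) / (\<beta> + 1) - \<alpha> * a))
             \<le> minimax_risk d m (horizons d \<C>) \<and>
           minimax_risk d m (horizons d \<C>)
             \<le> ennreal (C\<^sub>2 * real m powr (- \<beta> / (\<beta> + 1))
                     * ln (2 * real m) powr ((2 + \<beta> * b) / (\<beta> + 1)))"
proof -
  let ?H = "packing_entropy (L1_dist (cube_measure (d - 1))) \<C>"
  obtain c where c: "c > 0" "\<And>\<epsilon>. 0 < \<epsilon> \<Longrightarrow> \<epsilon> < 1 \<Longrightarrow>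
      ?H \<epsilon> \<le> ereal (c * (\<epsilon> powr (- 1 / \<beta>) * ln (2 + 1 / \<epsilon>) powr b))"
    using assms(7) by blast
  obtain c' where c': "c' > 0" "\<And>\<epsilon>. 0 < \<epsilon> \<Longrightarrow> \<epsilon> < 1 \<Longrightarrow>
      ereal (c' * (\<epsilon> powr (- 1 / \<alpha>) / ln (2 + 1 / \<epsilon>) powr a)) \<le> ?H \<epsilon>"
    using assms(8) by blast
  have "d \<ge> 1" "\<alpha> > 0" using assms by auto
  obtain C1 where C1: "C1 > 0" "\<And>m::nat. m \<ge> 1 \<Longrightarrow>
      \<exists>\<delta> \<epsilon>. 0 < \<delta> \<and> \<delta> < 1 \<and> 0 < \<epsilon> \<and> \<epsilon> < 1 \<and>
        ln 4 + c * (\<delta> powr (- 1 / \<beta>) * ln (2 + 1 / \<delta>) powr b) + 2 * real m * \<delta> * ln (real m + 1)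
          \<le> c' * (\<epsilon> powr (- 1 / \<alpha>) / ln (2 + 1 / \<epsilon>) powr a) \<and>
        C1 * real m powr (- \<alpha> / (\<beta> + 1))
            * ln (2 * real m) powr (- \<alpha> * (2 + \<beta> * b) / (\<beta> + 1) - \<alpha> * a) \<le> \<epsilon> / 16"
    using lower_rate[OF \<open>\<alpha> > 0\<close> \<open>\<beta> > 0\<close> \<open>a \<ge> 0\<close> \<open>b \<ge> 0\<close> c(1) c'(1)] by blast
  obtain C2 where C2: "C2 > 0" "\<And>m::nat. m \<ge> 1 \<Longrightarrow>
      1 \<le> C2 * real m powr (- \<beta> / (\<beta> + 1)) * ln (2 * real m) powr ((2 + \<beta> * b) / (\<beta> + 1)) \<or>
      (\<exists>\<epsilon>>0. \<epsilon> < 1 \<and>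
        4 * \<epsilon> + exp (c * (\<epsilon> powr (- 1 / \<beta>) * ln (2 + 1 / \<epsilon>) powr b) - real m * \<epsilon>)
          \<le> C2 * real m powr (- \<beta> / (\<beta> + 1)) * ln (2 * real m) powr ((2 + \<beta> * b) / (\<beta> + 1)))"
    using upper_rate[OF \<open>\<beta> > 0\<close> \<open>b \<ge> 0\<close> c(1)] by blast
  \<comment> \<open>The empty class has packing entropy \<open>ln 0 = 0\<close>, whereas the assumed
    lower bound is positive, for instance at \<open>\<epsilon> = 1 / 2\<close>.\<close>
  have "\<C> \<noteq> {}"
  proof
    assume "\<C> = {}"
    have "ereal (c' * ((1 / 2) powr (- 1 / \<alpha>) / ln (2 + 1 / (1 / 2)) powr a)) \<le> ?H (1 / 2)"
      by (rule c'(2)) simp_all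
    also have "?H (1 / 2) = ereal 0"
      using \<open>\<C> = {}\<close>
      by (simp add: packing_entropy_def packing_number_def packing_set_def zero_enat_def[symmetric])
         (simp add: zero_enat_def)
    finally have "c' * ((1 / 2) powr (- 1 / \<alpha>) / ln (2 + 1 / (1 / 2)) powr a) \<le> 0"
      by (simp only: ereal_less_eq(3))
    moreover have "c' * ((1 / 2) powr (- 1 / \<alpha>) / ln (2 + 1 / (1 / 2)) powr a) > 0"
      using c'(1) by simp
    ultimately show False by linarith
  qed
  have lower: "ennreal (C1 * real m powr (- \<alpha> / (\<beta> + 1))
        * ln (2 * real m) powr (- \<alpha> * (2 + \<beta> * b) / (\<beta> + 1) - \<alpha> * a))
      \<le> minimax_risk d m (horizons d \<C>)" if "m \<ge> 1" for m
  proof -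
    obtain \<delta> \<epsilon> where "0 < \<delta>" "\<delta> < 1" "0 < \<epsilon>" "\<epsilon> < 1"
      and bal: "ln 4 + c * (\<delta> powr (- 1 / \<beta>) * ln (2 + 1 / \<delta>) powr b) + 2 * real m * \<delta> * ln (real m + 1)
          \<le> c' * (\<epsilon> powr (- 1 / \<alpha>) / ln (2 + 1 / \<epsilon>) powr a)"
      and le: "C1 * real m powr (- \<alpha> / (\<beta> + 1))
            * ln (2 * real m) powr (- \<alpha> * (2 + \<beta> * b) / (\<beta> + 1) - \<alpha> * a) \<le> \<epsilon> / 16"
      using C1(2)[OF \<open>m \<ge> 1\<close>] by blast
    \<comment> \<open>The assumed upper bound on the entropy is used at both scales: at \<delta> for
      the size of the net, at \<epsilon> for the finiteness of the packing number.\<close>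
    have "ennreal (\<epsilon> / 16) \<le> minimax_risk d m (horizons d \<C>)"
      using \<open>0 < \<delta>\<close> \<open>\<delta> < 1\<close> \<open>0 < \<epsilon>\<close> \<open>\<epsilon> < 1\<close> \<open>m \<ge> 1\<close> \<open>d \<ge> 1\<close> assms(2)
      by (intro minimax_risk_lower[OF _ _ _ _ _ c(2) c(2) c'(2) bal])
    with ennreal_leI[OF le] show ?thesis by (rule order_trans)
  qed
  have upper: "minimax_risk d m (horizons d \<C>) \<le> ennreal (C2 * real m powr (- \<beta> / (\<beta> + 1))
        * ln (2 * real m) powr ((2 + \<beta> * b) / (\<beta> + 1)))" (is "_ \<le> ennreal ?\<kappa>") if "m \<ge> 1" for m
    using C2(2)[OF that]
  proof
    assume "1 \<le> ?\<kappa>"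
    then have "ennreal 1 \<le> ennreal ?\<kappa>" by (rule ennreal_leI)
    with minimax_risk_le_one[OF assms(2), of m] show ?thesis
      unfolding ennreal_1 by (rule order_trans)
  next
    assume "\<exists>\<epsilon>>0. \<epsilon> < 1 \<and>
        4 * \<epsilon> + exp (c * (\<epsilon> powr (- 1 / \<beta>) * ln (2 + 1 / \<epsilon>) powr b) - real m * \<epsilon>) \<le> ?\<kappa>"
    then obtain \<epsilon> where "0 < \<epsilon>" "\<epsilon> < 1"
      and le: "4 * \<epsilon> + exp (c * (\<epsilon> powr (- 1 / \<beta>) * ln (2 + 1 / \<epsilon>) powr b) - real m * \<epsilon>) \<le> ?\<kappa>"
      by blast
    show ?thesis
      by (rule order_trans[OF minimax_risk_upper[OF \<open>d \<ge> 1\<close> assms(2) \<open>\<C> \<noteq> {}\<close> \<open>0 < \<epsilon>\<close>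
          c(2)[OF \<open>0 < \<epsilon>\<close> \<open>\<epsilon> < 1\<close>]] ennreal_leI[OF le]])
  qed
  show ?thesis
    by (intro exI[of _ C1] exI[of _ C2] conjI allI impI C1(1) C2(1) lower upper)
qed

thm_deps corollary3p15

end
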